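(* Let $d(n)$ denote the number of positive divisors of $n$, and let $\mathcal{L}\subseteq\mathbb{R}$ be the closure of the set of all real numbers $\alpha$ for which there exist infinitely many positive integers $n$ with $\alpha=\log\frac{d(n+1)}{d(n)}$. For real $x>0$ let $\mathcal{L}_+(x)$ be the Lebesgue measure of $\mathcal{L}\cap[0,x]$ and let $\mathcal{L}_-(x)$ be the Lebesgue measure of $\mathcal{L}\cap[-x,0]$. Then: (1) For every positive real number $x$ we have $\min(\mathcal{L}_+(x),\mathcal{L}_-(x))\geq\frac{x}{2}$. (2) We have \[ \limsup_{x\rightarrow\infty}\frac{1}{x}\min(\mathcal{L}_+(x),\mathcal{L}_-(x))\geq\frac{2}{3}. \]
   Context: For a positive integer $n$, $d(n)$ is the number of positive divisors of $n$, and $\log$ is the natural logarithm. Closure is taken in $\mathbb{R}$ with its usual topology. *)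

theory Defs
  imports "HOL-Analysis.Analysis"
begin

definition divisor_count :: "nat \<Rightarrow> nat" where
  "divisor_count n = card {k. k dvd n}"

definition limit_set :: "real set" where
  "limit_set = closure {\<alpha>. infinite {n::nat. n > 0 \<and>
     \<alpha> = ln (real (divisor_count (n + 1)) / real (divisor_count n))}}"

(* limit_set is closed, so both sets below are compact and the real-valued
   measure agrees with the extended one. *)

definition L_plus :: "real \<Rightarrow> real" where
  "L_plus x = measure lebesgue (limit_set \<inter> {0..x})"

definition L_minus :: "real \<Rightarrow> real" where
  "L_minus x = measure lebesgue (limit_set \<inter> {-x..0})"

end

theory Submission
  imports Defs "HOL-Number_Theory.Number_Theory" "HOL-Real_Asymp.Real_Asymp"
begin

text \<open>
  In fact every positive rational \<open>a/b\<close> equals \<open>d(n+1)/d(n)\<close> for infinitely many \<open>n\<close>, so the closure is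
  all of \<open>\<real>\<close>. Take \<open>k\<close> shifts \<open>h\<^sub>0 < \<dots> < h\<^bsub>k-1\<^esub>\<close> and put \<open>u\<^sub>i = N + h\<^sub>i + W n\<close>. If the difference
  \<open>g = h\<^sub>j - h\<^sub>i\<close> divides \<open>u\<^sub>i\<close>, then \<open>u\<^sub>i/g\<close> and \<open>u\<^sub>j/g\<close> are consecutive. Write \<open>u\<^sub>i = w\<^sub>i L\<^sub>i(n)\<close> with \<open>w\<^sub>i\<close> composed
  of the primes of \<open>W\<close> and \<open>L\<^sub>i(n)\<close> coprime to \<open>W\<close>. The shifts and \<open>N\<close> can be chosen such that
  \<open>d(w\<^sub>j/g) / d(w\<^sub>i/g) = a/b\<close> for \<^emph>\<open>all\<close> pairs \<open>i < j\<close>, so it is enough to find a single pair with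
  \<open>d(L\<^sub>i(n)) = d(L\<^sub>j(n))\<close>. For most \<open>n\<close> up to \<open>x\<close> most \<open>L\<^sub>i(n)\<close> are squarefree, and by the
  Turan-Kubilius variance bound their numbers of prime factors lie in a common interval of length
  \<open>O(\<surd>(log log x))\<close>; if \<open>k\<close> is a large multiple of \<open>\<surd>(log log x)\<close>, two of them agree by pigeonhole. This
  forces \<open>k\<close> to grow with \<open>x\<close>, which is why \<open>W\<close> has to be bounded explicitly: it is at most
  \<open>exp(k\<^bsup>O(k)\<^esup>)\<close>, far below \<open>x = exp(exp(c k\<^sup>2))\<close>.
\<close>

section \<open>The divisor function and small primes\<close>

lemma divisor_count_mult:
  assumes "coprime a b"
  shows "divisor_count (a * b) = divisor_count a * divisor_count b"
proof -
  have "bij_betw (\<lambda>(x, y). x * y) ({k. k dvd a} \<times> {k. k dvd b}) {k. k dvd a * b}"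
  proof (rule bij_betw_imageI)
    show "inj_on (\<lambda>(x, y). x * y) ({k. k dvd a} \<times> {k. k dvd b})"
    proof (rule inj_onI, clarsimp)
      fix x y x' y' assume d: "x dvd a" "y dvd b" "x' dvd a" "y' dvd b" and eq: "x * y = x' * y'"
      have "coprime x y'" "coprime x' y" "coprime y x'" "coprime y' x"
        using d assms by (metis coprime_divisors coprime_commute)+
      then have "x dvd x'" "x' dvd x" "y dvd y'" "y' dvd y"
        using eq by (metis coprime_dvd_mult_left_iff coprime_dvd_mult_right_iff dvd_triv_left dvd_triv_right)+
      then show "x = x' \<and> y = y'" by (auto intro: dvd_antisym)
    qed
    show "(\<lambda>(x, y). x * y) ` ({k. k dvd a} \<times> {k. k dvd b}) = {k. k dvd a * b}"
    proof (intro equalityI subsetI)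
      fix k assume "k \<in> {k. k dvd a * b}"
      then obtain x y where "k = x * y" "x dvd a" "y dvd b"
        using division_decomp by blast
      then show "k \<in> (\<lambda>(x, y). x * y) ` ({k. k dvd a} \<times> {k. k dvd b})" by auto
    qed (auto intro: mult_dvd_mono)
  qed
  then show ?thesis
    by (simp add: divisor_count_def card_cartesian_product bij_betw_same_card[symmetric])
qed

lemma divisor_count_prime_power:
  assumes "prime p"
  shows "divisor_count (p ^ e) = e + 1"
proof -
  have "{k. k dvd p ^ e} = (\<lambda>i. p ^ i) ` {..e}"
    using assms by (auto simp: divides_primepow_nat)
  moreover have "inj_on (\<lambda>i. p ^ i) {..e}"
    using prime_gt_1_nat[OF assms] by (intro inj_onI) (simp add: power_inject_exp)
  ultimately show ?thesis
    by (simp add: divisor_count_def card_image)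
qed

lemma divisor_count_prod_prime_powers:
  assumes "finite A" "\<And>p. p \<in> A \<Longrightarrow> prime p"
  shows "divisor_count (\<Prod>p\<in>A. p ^ f p) = (\<Prod>p\<in>A. f p + 1)"
  using assms
proof (induction A rule: finite_induct)
  case empty
  have "{k. k dvd (1::nat)} = {1}" by auto
  then show ?case by (simp add: divisor_count_def)
next
  case (insert p A)
  have "coprime (p ^ f p) (\<Prod>q\<in>A. q ^ f q)"
  proof (rule prod_coprime_right)
    fix q assume "q \<in> A"
    then have "coprime p q" using insert by (intro primes_coprime) auto
    then show "coprime (p ^ f p) (q ^ f q)" by simp
  qed
  then show ?case
    using insert by (simp add: divisor_count_mult divisor_count_prime_power)
qed

lemma divisor_count_squarefree:
  fixes n :: nat
  assumes "n > 0" "\<And>p. prime p \<Longrightarrow> \<not> p\<^sup>2 dvd n"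
  shows "divisor_count n = 2 ^ card (prime_factors n)"
proof -
  have "multiplicity p n = 1" if "p \<in> prime_factors n" for p
  proof -
    have "multiplicity p n < 2"
      using assms that by (intro multiplicity_lessI) (auto simp: prime_factors_dvd)
    moreover have "multiplicity p n > 0"
      using that by (simp add: prime_factors_multiplicity)
    ultimately show ?thesis by simp
  qed
  then have "n = (\<Prod>p\<in>prime_factors n. p ^ 1)"
    using prime_factorization_nat[OF assms(1)] by simp
  then have "divisor_count n = divisor_count (\<Prod>p\<in>prime_factors n. p ^ 1)" by simp
  also have "\<dots> = (\<Prod>p\<in>prime_factors n. 1 + 1)"
    by (rule divisor_count_prod_prime_powers) auto
  finally show ?thesis by (simp add: numeral_2_eq_2)
qed

lemma divisor_count_pos: "n > 0 \<Longrightarrow> divisor_count n > 0"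
  using finite_divisors_nat[of n] one_dvd[of n]
  unfolding divisor_count_def card_gt_0_iff by blast

section \<open>Supply of primes of bounded size\<close>

text \<open>An integer up to \<open>2 ^ a\<close> is determined by its exponents at the primes up to
  \<open>2 ^ a\<close>, and each exponent lies in \<open>{0..a}\<close>. Counting exponent vectors
  gives a weak but explicit lower bound for the number of primes.\<close>

lemma card_primes_le_power2:
  "(2::nat) ^ a \<le> (a + 1) ^ card {p::nat. prime p \<and> p \<le> 2 ^ a}"
proof -
  define P where "P = {p::nat. prime p \<and> p \<le> 2 ^ a}"
  have fin: "finite P" unfolding P_def by auto
  define F where "F = (\<lambda>n::nat. restrict (\<lambda>p. multiplicity p n) P)"
  have "inj_on F {1..(2::nat) ^ a}"
  proof (rule inj_onI)
    fix m n :: nat assume mn: "m \<in> {1..(2::nat) ^ a}" "n \<in> {1..(2::nat) ^ a}" and eq: "F m = F n"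
    have *: "multiplicity p m = multiplicity p n" if p: "prime p" for p
    proof (cases "p \<in> P")
      case True
      then show ?thesis using eq unfolding F_def by (metis restrict_apply')
    next
      case False
      then have "p > 2 ^ a" using p by (auto simp: P_def)
      then have "\<not> p dvd m" "\<not> p dvd n" using mn by (auto dest!: dvd_imp_le)
      then show ?thesis by (simp add: not_dvd_imp_multiplicity_0)
    qed
    show "m = n"
      by (rule multiplicity_eq_nat) (use mn in \<open>simp_all add: *\<close>)
  qed
  moreover have "F ` {1..(2::nat) ^ a} \<subseteq> PiE P (\<lambda>_. {0..a})"
  proof (rule image_subsetI, unfold F_def, rule restrict_PiE_iff[THEN iffD2], rule ballI)
    fix n p :: nat assume "n \<in> {1..(2::nat) ^ a}" and "p \<in> P"
    then have n: "n > 0" "n \<le> 2 ^ a" and p: "prime p" by (auto simp: P_def)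
    have "(2::nat) ^ multiplicity p n \<le> p ^ multiplicity p n"
      using prime_ge_2_nat[OF p] by (intro power_mono) auto
    also have "\<dots> \<le> n" using n by (intro dvd_imp_le multiplicity_dvd) auto
    also note n(2)
    finally show "multiplicity p n \<in> {0..a}" by simp
  qed
  moreover have "finite (PiE P (\<lambda>_. {0..a}))"
    using fin by (intro finite_PiE) auto
  ultimately have "card {1..(2::nat) ^ a} \<le> card (PiE P (\<lambda>_. {0..a}))"
    by (rule card_inj_on_le)
  then show ?thesis using fin by (simp add: card_PiE P_def)
qed

text \<open>Fresh primes must come with an explicit size, since they later enter \<open>W\<close>.
  Fewer than \<open>m\<close> primes up to \<open>2 ^ (m^2)\<close> would give
  \<open>2 ^ (m^2) < (2 ^ m) ^ m\<close> by the preceding count; \<open>m\<close> makes room for the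
  \<open>n\<close> wanted primes and the excluded ones.\<close>

lemma obtain_small_primes:
  fixes A :: "nat set"
  assumes "finite A"
  obtains P where "finite P" "card P = n" "\<And>p. p \<in> P \<Longrightarrow> prime p" "P \<inter> A = {}"
    "\<And>p. p \<in> P \<Longrightarrow> p \<le> 2 ^ ((n + card A + 5)\<^sup>2)"
proof -
  define m where "m = n + card A + 5"
  define Q where "Q = {p::nat. prime p \<and> p \<le> 2 ^ (m\<^sup>2)}"
  have m5: "m \<ge> 5" by (simp add: m_def)
  \<comment> \<open>The summand 5 in \<open>m\<close> serves this inequality, which fails for 2, 3
    and 4.\<close>
  have small: "m\<^sup>2 + 1 \<le> 2 ^ m"
    using m5
  proof (induction m rule: nat_induct_at_least)
    case (Suc m)
    have "(Suc m)\<^sup>2 + 1 \<le> 2 * (m\<^sup>2 + 1)"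
      using Suc.hyps mult_le_mono1[of 2 m m] by (simp add: power2_eq_square mult_2)
    then show ?case using Suc by simp
  qed simp
  have "m \<le> card Q"
  proof (rule ccontr)
    assume "\<not> m \<le> card Q"
    then have lt: "card Q < m" by simp
    have "(2::nat) ^ (m\<^sup>2) \<le> (m\<^sup>2 + 1) ^ card Q"
      using card_primes_le_power2[of "m\<^sup>2"] by (simp add: Q_def)
    also have "\<dots> < (m\<^sup>2 + 1) ^ m"
      using lt m5 by (intro power_strict_increasing) auto
    also have "\<dots> \<le> (2 ^ m) ^ m" using small by (rule power_mono) simp
    finally show False by (simp add: power_mult[symmetric] power2_eq_square)
  qed
  moreover have "card Q - card A \<le> card (Q - A)"
    using assms by (simp add: diff_card_le_card_Diff)
  ultimately have "n \<le> card (Q - A)" by (simp add: m_def)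
  then obtain P where "P \<subseteq> Q - A" "card P = n" "finite P"
    using obtain_subset_with_card_n by metis
  then show ?thesis using that[of P] by (auto simp: Q_def m_def)
qed

section \<open>Linear forms with equal divisor counts\<close>

lemma prod_primes_dvd:
  fixes n :: nat
  assumes "finite A" "\<And>p. p \<in> A \<Longrightarrow> prime p" "\<And>p. p \<in> A \<Longrightarrow> p dvd n"
  shows "\<Prod>A dvd n"
  using assms
proof (induction A rule: finite_induct)
  case (insert p A)
  have "coprime p (\<Prod>A)"
    using insert by (intro prod_coprime_right primes_coprime) auto
  then show ?case using insert by (auto intro: divides_mult)
qed simp

lemma power_card_le_prod:
  fixes x :: nat
  assumes "finite A" "\<And>a. a \<in> A \<Longrightarrow> x \<le> a"
  shows "x ^ card A \<le> \<Prod>A"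
  using prod_mono[of A "\<lambda>_. x" "\<lambda>a. a"] assms by simp

section \<open>Upper bounds of Chebyshev and Mertens type\<close>

text \<open>Chebyshev's argument: with \<open>n = 2 ^ j\<close>, each prime between \<open>n\<close>
  and \<open>2 * n\<close> divides \<open>2 * n choose n\<close>, which is at most
  \<open>2 ^ (2 * n)\<close>, while the product of these primes is at least
  \<open>n ^ card A\<close>.\<close>

lemma card_primes_power2_interval:
  assumes "j > 0"
  shows "j * card {p. prime p \<and> 2 ^ j < p \<and> p \<le> (2::nat) ^ (j + 1)} \<le> 2 ^ (j + 1)"
proof -
  define n :: nat where "n = 2 ^ j"
  define A where "A = {p. prime p \<and> 2 ^ j < p \<and> p \<le> (2::nat) ^ (j + 1)}"
  have fin: "finite A" by (rule finite_subset[of _ "{..2 ^ (j + 1)}"]) (auto simp: A_def)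
  have "p dvd (2 * n choose n)" if "p \<in> A" for p
  proof -
    have p: "prime p" "n < p" "p \<le> 2 * n" using that by (auto simp: A_def n_def)
    have "fact n * fact n * (2 * n choose n) = (fact (2 * n) :: nat)"
      using binomial_fact_lemma[of n "2 * n"] by (simp add: mult_2)
    moreover have "p dvd fact (2 * n)" using p by (simp add: prime_dvd_fact_iff)
    ultimately have "p dvd fact n * fact n * (2 * n choose n)" by simp
    then show ?thesis
      using p by (simp add: prime_dvd_mult_iff prime_dvd_fact_iff)
  qed
  then have "\<Prod>A dvd (2 * n choose n)"
    using fin by (intro prod_primes_dvd) (auto simp: A_def)
  then have "\<Prod>A \<le> (2 * n choose n)"
    by (intro dvd_imp_le) auto
  also have "\<dots> \<le> 2 ^ (2 * n)" by (rule binomial_le_pow2)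
  finally have "n ^ card A \<le> 2 ^ (2 * n)"
    using power_card_le_prod[OF fin, of n] by (force simp: A_def n_def)
  then have "(2::nat) ^ (j * card A) \<le> 2 ^ (2 ^ (j + 1))"
    by (simp add: n_def power_mult)
  then show ?thesis by (simp add: A_def)
qed

definition prime_recip_sum :: "nat \<Rightarrow> real" where
  "prime_recip_sum x = (\<Sum>p | prime p \<and> p \<le> x. 1 / real p)"

lemma prime_recip_sum_power2_Suc:
  assumes "j > 0"
  shows "prime_recip_sum (2 ^ (j + 1)) \<le> prime_recip_sum (2 ^ j) + 2 / real j"
proof -
  define A where "A = {p. prime p \<and> 2 ^ j < p \<and> p \<le> (2::nat) ^ (j + 1)}"
  have fin: "finite A" by (rule finite_subset[of _ "{..2 ^ (j + 1)}"]) (auto simp: A_def)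
  have split: "{p. prime p \<and> p \<le> (2::nat) ^ (j + 1)} = {p. prime p \<and> p \<le> 2 ^ j} \<union> A"
    by (auto simp: A_def)
  have "prime_recip_sum (2 ^ (j + 1)) = prime_recip_sum (2 ^ j) + (\<Sum>p\<in>A. 1 / real p)"
    unfolding prime_recip_sum_def split
    by (rule sum.union_disjoint) (auto simp: fin, auto simp: A_def)
  also have "(\<Sum>p\<in>A. 1 / real p) \<le> (\<Sum>p\<in>A. 1 / 2 ^ j)"
  proof (rule sum_mono)
    fix p assume "p \<in> A"
    then have "real (2 ^ j) \<le> real p" unfolding A_def by (intro of_nat_mono) auto
    then show "1 / real p \<le> 1 / 2 ^ j"
      using frac_le[of 1 1 "2 ^ j" "real p"] by simp
  qed
  also have "(\<Sum>p\<in>A. 1 / 2 ^ j) = real (card A) / 2 ^ j" by simp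
  also have "\<dots> \<le> 2 / real j"
  proof -
    have "real (j * card A) \<le> real (2 ^ (j + 1))"
      using card_primes_power2_interval[OF assms] unfolding A_def by (rule of_nat_mono)
    then show ?thesis using assms by (simp add: field_simps)
  qed
  finally show ?thesis by simp
qed

text \<open>A weak form of Mertens' theorem. Passing from \<open>m\<close> to \<open>Suc m\<close>
  adds the \<open>j = 2 ^ m\<close> dyadic blocks above \<open>2 ^ j\<close>; each contributes at
  most \<open>2 / j\<close>, so together at most 2.\<close>

lemma prime_recip_sum_le:
  "prime_recip_sum (2 ^ (2 ^ m)) \<le> 2 * real m + 1"
proof (induction m)
  case 0
  have "{p::nat. prime p \<and> p \<le> 2} = {2}"
    using prime_ge_2_nat by (auto simp: order_antisym)
  then show ?case by (simp add: prime_recip_sum_def)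
next
  case (Suc m)
  define j :: nat where "j = 2 ^ m"
  have j: "j > 0" by (simp add: j_def)
  have "prime_recip_sum (2 ^ (j + d)) \<le> prime_recip_sum (2 ^ j) + real d * (2 / real j)" for d
  proof (induction d)
    case (Suc d)
    have "prime_recip_sum (2 ^ (j + Suc d)) \<le> prime_recip_sum (2 ^ (j + d)) + 2 / real (j + d)"
      using prime_recip_sum_power2_Suc[of "j + d"] j by simp
    also have "2 / real (j + d) \<le> 2 / real j"
      using j by (intro divide_left_mono) auto
    finally show ?case using Suc by (simp add: add_divide_distrib)
  qed simp
  from this[of j] have "prime_recip_sum (2 ^ (j + j)) \<le> prime_recip_sum (2 ^ j) + 2"
    using j by simp
  moreover have "j + j = 2 ^ Suc m" by (simp add: j_def)
  ultimately show ?case using Suc by (simp add: j_def flip: mult_2)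
qed

lemma sum_inverse_squares_le:
  fixes A :: "nat set"
  assumes "finite A" "\<And>n. n \<in> A \<Longrightarrow> k < n" "k > 0"
  shows "(\<Sum>n\<in>A. 1 / (real n)\<^sup>2) \<le> 1 / real k"
proof -
  have *: "(\<Sum>n=Suc k..k + d. 1 / (real n)\<^sup>2) \<le> 1 / real k - 1 / real (k + d)" for d
  proof (induction d)
    case (Suc d)
    have "(\<Sum>n=Suc k..k + Suc d. 1 / (real n)\<^sup>2) =
      (\<Sum>n=Suc k..k + d. 1 / (real n)\<^sup>2) + 1 / (real (k + Suc d))\<^sup>2"
      by simp
    also have "1 / (real (k + Suc d))\<^sup>2 \<le> 1 / real (k + d) - 1 / real (k + Suc d)"
    proof -
      define x where "x = real (k + d)"
      have x: "x > 0" using assms by (simp add: x_def)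
      have "1 / (x + 1)\<^sup>2 \<le> 1 / (x * (x + 1))"
        using x by (intro divide_left_mono) (auto simp: power2_eq_square)
      also have "\<dots> = 1 / x - 1 / (x + 1)" using x by (simp add: field_simps)
      finally show ?thesis by (simp add: x_def algebra_simps)
    qed
    finally show ?case using Suc by linarith
  qed simp
  obtain d where d: "\<forall>n\<in>A. n \<le> d" using assms(1) finite_nat_set_iff_bounded_le by blast
  have "(\<Sum>n\<in>A. 1 / (real n)\<^sup>2) \<le> (\<Sum>n=Suc k..k + d. 1 / (real n)\<^sup>2)"
    using assms d by (intro sum_mono2) force+
  also have "\<dots> \<le> 1 / real k - 1 / real (k + d)" by (rule *)
  also have "\<dots> \<le> 1 / real k" by simp
  finally show ?thesis .
qed

section \<open>Divisibility statistics of a linear form\<close>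

text \<open>As \<open>A\<close> is invertible modulo \<open>m\<close>, the divisibility selects
  exactly one residue class of \<open>n\<close>, which the first \<open>X\<close> integers meet
  \<open>X / m\<close> times up to an error of 1.\<close>

lemma card_dvd_linear:
  fixes A B m X :: nat
  assumes "coprime A m" "m > 0"
  shows "real (card {n. n < X \<and> m dvd B + A * n}) \<le> real X / real m + 1"
    and "real X / real m - 1 \<le> real (card {n. n < X \<and> m dvd B + A * n})"
proof -
  obtain x where x: "[A * x = 1] (mod m)"
    using cong_solve_coprime_nat[OF assms(1)] by auto
  \<comment> \<open>The root of \<open>B + A * n\<close> modulo \<open>m\<close>; the factor
    \<open>(m - 1) * B\<close> represents \<open>-B\<close> within the naturals.\<close>
  define n0 where "n0 = (x * ((m - 1) * B)) mod m"
  have n0: "n0 < m" using assms by (simp add: n0_def)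
  have "[B + A * n0 = B + A * (x * ((m - 1) * B))] (mod m)"
    unfolding n0_def by (intro cong_add cong_mult cong_refl) (simp add: cong_def)
  also have "B + A * (x * ((m - 1) * B)) = B + (A * x) * ((m - 1) * B)" by (simp add: algebra_simps)
  also have "[\<dots> = B + 1 * ((m - 1) * B)] (mod m)"
    by (intro cong_add cong_mult cong_refl x)
  also have "B + 1 * ((m - 1) * B) = m * B"
    using assms by (cases m) auto
  also have "[m * B = 0] (mod m)" by (simp add: cong_def)
  finally have z: "[B + A * n0 = 0] (mod m)" .
  have iff: "m dvd B + A * n \<longleftrightarrow> n mod m = n0" for n
  proof -
    have "m dvd B + A * n \<longleftrightarrow> [B + A * n = B + A * n0] (mod m)"
      using z by (metis cong_0_iff cong_dvd_iff cong_sym cong_trans)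
    also have "\<dots> \<longleftrightarrow> [A * n = A * n0] (mod m)" by (simp add: cong_add_lcancel_nat)
    also have "\<dots> \<longleftrightarrow> [n = n0] (mod m)"
      using assms by (simp add: cong_mult_lcancel_nat coprime_commute)
    also have "\<dots> \<longleftrightarrow> n mod m = n0" using n0 by (simp add: cong_def)
    finally show ?thesis .
  qed
  define S where "S = {n. n < X \<and> m dvd B + A * n}"
  have finS: "finite S" by (simp add: S_def)
  have "S \<subseteq> (\<lambda>q. n0 + m * q) ` {..<X div m + 1}"
  proof
    fix n assume "n \<in> S"
    then have "n < X" "n mod m = n0" by (auto simp: S_def iff)
    then have "n = n0 + m * (n div m)" "n div m < X div m + 1"
      by (auto simp: div_le_mono le_imp_less_Suc)
    then show "n \<in> (\<lambda>q. n0 + m * q) ` {..<X div m + 1}" by blast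
  qed
  then have "card S \<le> card {..<X div m + 1}" by (intro surj_card_le) auto
  then have up: "real (card S) \<le> real (X div m) + 1" by simp
  have "(\<lambda>q. n0 + m * q) ` {..<X div m} \<subseteq> S"
  proof
    fix n assume "n \<in> (\<lambda>q. n0 + m * q) ` {..<X div m}"
    then obtain q where q: "q < X div m" "n = n0 + m * q" by blast
    have "n < m * (q + 1)" using q n0 by simp
    also have "\<dots> \<le> m * (X div m)" using q by (intro mult_le_mono) auto
    also have "\<dots> \<le> X" by simp
    finally show "n \<in> S" using q n0 by (simp add: S_def iff)
  qed
  moreover have "inj_on (\<lambda>q. n0 + m * q) {..<X div m}" using assms by (intro inj_onI) auto
  ultimately have "card {..<X div m} \<le> card S" using finS by (metis card_image card_mono)
  then have lo: "real (X div m) \<le> real (card S)" by simp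
  have "real X = real m * real (X div m) + real (X mod m)"
    by (metis mult_div_mod_eq of_nat_add of_nat_mult)
  moreover have "real (X mod m) < real m" using assms by simp
  ultimately have "real X / real m < real (X div m) + 1" "real (X div m) \<le> real X / real m"
    using assms by (simp_all add: field_simps)
  then show "real (card {n. n < X \<and> m dvd B + A * n}) \<le> real X / real m + 1"
    "real X / real m - 1 \<le> real (card {n. n < X \<and> m dvd B + A * n})"
    using up lo unfolding S_def by linarith+
qed

text \<open>Expand the square into pairs \<open>p\<close>, \<open>q\<close> from \<open>P\<close>.
  Off the diagonal the densities cancel and only rounding errors remain, at most 3 per pair; the
  diagonal supplies \<open>X / p\<close>.\<close>

lemma turan_kubilius:
  fixes A B X :: nat
  assumes P: "finite P" "\<And>p. p \<in> P \<Longrightarrow> prime p" "\<And>p. p \<in> P \<Longrightarrow> coprime A p"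
  defines "M \<equiv> (\<Sum>p\<in>P. 1 / real p)"
  shows "(\<Sum>n<X. (real (card {p\<in>P. p dvd B + A * n}) - M)\<^sup>2) \<le> real X * M + 3 * (real (card P))\<^sup>2"
proof -
  define I :: "nat \<Rightarrow> nat \<Rightarrow> real" where "I = (\<lambda>p n. of_bool (p dvd B + A * n))"
  define S where "S = (\<lambda>m. real (card {n. n < X \<and> m dvd B + A * n}))"
  have sumI: "(\<Sum>n<X. I m n) = S m" for m
    by (simp add: I_def S_def Int_def)
  have c: "real (card {p\<in>P. p dvd B + A * n}) - M = (\<Sum>p\<in>P. I p n - 1 / real p)" for n
    using P(1) by (simp add: I_def M_def sum_subtractf Int_def)
  have pq: "(\<Sum>n<X. (I p n - 1 / real p) * (I q n - 1 / real q)) \<le> (if p = q then real X / real p else 0) + 3"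
    if p: "p \<in> P" and q: "q \<in> P" for p q
  proof -
    have p2: "real p \<ge> 2" "real q \<ge> 2" using prime_ge_2_nat P(2) p q by force+
    have bp: "S p \<le> real X / real p + 1" "real X / real p - 1 \<le> S p"
      and bq: "S q \<le> real X / real q + 1" "real X / real q - 1 \<le> S q"
      using card_dvd_linear[of A p X B] card_dvd_linear[of A q X B] P p q p2 by (auto simp: S_def)
    have exp: "(\<Sum>n<X. (I p n - 1 / real p) * (I q n - 1 / real q)) =
       (\<Sum>n<X. I p n * I q n) - S p / real q - S q / real p + real X / (real p * real q)"
      unfolding sumI[symmetric]
      by (simp add: algebra_simps sum.distrib sum_subtractf sum_divide_distrib sum_distrib_left)
    show ?thesis
    proof (cases "p = q")
      case True
      have "(\<Sum>n<X. I p n * I q n) = S p"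
        unfolding sumI[symmetric] True by (intro sum.cong) (auto simp: I_def)
      then have "(\<Sum>n<X. (I p n - 1 / real p) * (I q n - 1 / real q)) =
          S p * (1 - 2 / real p) + real X / (real p * real p)"
        unfolding exp using True by (simp add: algebra_simps)
      also have "\<dots> \<le> (real X / real p + 1) * (1 - 2 / real p) + real X / (real p * real p)"
        using bp p2 by (intro add_right_mono mult_right_mono) auto
      also have "\<dots> = real X / real p + 1 - 2 / real p - real X / (real p * real p)"
        using p2 by (simp add: field_simps)
      also have "\<dots> \<le> real X / real p + 3"
      proof -
        have "0 \<le> 2 / real p" "0 \<le> real X / (real p * real p)" by auto
        then show ?thesis by linarith
      qed
      finally show ?thesis using True by simp
    next
      case False
      have cop: "coprime p q" using False P p q by (intro primes_coprime) auto
      have "(\<Sum>n<X. I p n * I q n) = S (p * q)"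
        unfolding sumI[symmetric] I_def of_bool_conj[symmetric]
        by (intro sum.cong refl arg_cong[of _ _ of_bool]) (use cop in \<open>auto intro: divides_mult dvd_mult_left dvd_mult_right\<close>)
      also have "\<dots> \<le> real X / (real p * real q) + 1"
        using card_dvd_linear(1)[of A "p * q" X B] P p q p2 by (auto simp: S_def)
      finally have s: "(\<Sum>n<X. I p n * I q n) \<le> real X / (real p * real q) + 1" .
      \<comment> \<open>\<open>S p\<close> and \<open>S q\<close> enter with negative sign, so their
        lower bounds are needed. Their errors \<open>1 / q\<close> and \<open>1 / p\<close>,
        together with the error 1 of \<open>S (p * q)\<close>, make up the 3.\<close>
      have "(real X / real p - 1) / real q \<le> S p / real q"
        using bp p2 by (intro divide_right_mono) auto
      moreover have "(real X / real q - 1) / real p \<le> S q / real p"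
        using bq p2 by (intro divide_right_mono) auto
      moreover have "(real X / real p - 1) / real q = real X / (real p * real q) - 1 / real q"
        "(real X / real q - 1) / real p = real X / (real p * real q) - 1 / real p"
        using p2 by (simp_all add: field_simps)
      moreover have "1 / real p \<le> 1" "1 / real q \<le> 1" using p2 by auto
      ultimately show ?thesis using exp s False by simp
    qed
  qed
  have "(\<Sum>n<X. (real (card {p\<in>P. p dvd B + A * n}) - M)\<^sup>2) =
      (\<Sum>n<X. \<Sum>p\<in>P. \<Sum>q\<in>P. (I p n - 1 / real p) * (I q n - 1 / real q))"
    unfolding c power2_eq_square sum_product ..
  also have "\<dots> = (\<Sum>p\<in>P. \<Sum>n<X. \<Sum>q\<in>P. (I p n - 1 / real p) * (I q n - 1 / real q))"
    by (rule sum.swap)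
  also have "\<dots> = (\<Sum>p\<in>P. \<Sum>q\<in>P. \<Sum>n<X. (I p n - 1 / real p) * (I q n - 1 / real q))"
    by (intro sum.cong refl sum.swap)
  also have "\<dots> \<le> (\<Sum>p\<in>P. \<Sum>q\<in>P. (if p = q then real X / real p else 0) + 3)"
    by (intro sum_mono pq)
  also have "\<dots> = (\<Sum>p\<in>P. real X / real p) + 3 * (real (card P))\<^sup>2"
    using P(1) by (simp add: sum.distrib power2_eq_square)
  also have "(\<Sum>p\<in>P. real X / real p) = real X * M"
    by (simp add: M_def sum_distrib_left)
  finally show ?thesis .
qed

text \<open>Chebyshev's inequality applied to the variance bound.\<close>

lemma card_large_deviation_le:
  fixes A B X :: nat
  assumes P: "finite P" "\<And>p. p \<in> P \<Longrightarrow> prime p" "\<And>p. p \<in> P \<Longrightarrow> coprime A p"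
    and "T \<ge> 0"
  defines "M \<equiv> (\<Sum>p\<in>P. 1 / real p)"
  shows "T\<^sup>2 * real (card {n. n < X \<and> T < \<bar>real (card {p\<in>P. p dvd B + A * n}) - M\<bar>})
    \<le> real X * M + 3 * (real (card P))\<^sup>2"
proof -
  define f where "f = (\<lambda>n. \<bar>real (card {p\<in>P. p dvd B + A * n}) - M\<bar>)"
  have "T\<^sup>2 * real (card {n. n < X \<and> T < f n}) = (\<Sum>n\<in>{n. n < X \<and> T < f n}. T\<^sup>2)" by simp
  also have "\<dots> \<le> (\<Sum>n\<in>{n. n < X \<and> T < f n}. (f n)\<^sup>2)"
    using assms(4) by (intro sum_mono power_mono) auto
  also have "\<dots> \<le> (\<Sum>n<X. (f n)\<^sup>2)" by (intro sum_mono2) auto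
  also have "\<dots> \<le> real X * M + 3 * (real (card P))\<^sup>2"
    using turan_kubilius[OF P, where X = X and B = B] by (simp add: f_def M_def)
  finally show ?thesis by (simp add: f_def)
qed

text \<open>Primes up to \<open>k\<close> divide \<open>W\<close> and hence no value of the form, so
  only primes above \<open>k\<close> matter, and their inverse squares sum to at most
  \<open>1 / k\<close>. They are also below \<open>Z\<close>, and each costs a rounding error of at
  most 1, which gives the term \<open>Z\<close>.\<close>

lemma card_square_divisible_le:
  fixes A B X k Z W :: nat
  assumes W: "\<And>p. prime p \<Longrightarrow> p \<le> k \<Longrightarrow> p dvd W" "A dvd W"
    and cop: "\<And>n. coprime (B + A * n) W"
    and Z: "\<And>n. n < X \<Longrightarrow> B + A * n < Z\<^sup>2" "\<And>n. B + A * n > 0" and k: "k > 0"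
  shows "real (card {n. n < X \<and> (\<exists>p. prime p \<and> p\<^sup>2 dvd B + A * n)}) \<le> real X / real k + real Z"
proof -
  define Q where "Q = {p. prime p \<and> k < p \<and> p < Z \<and> \<not> p dvd W}"
  define S where "S = (\<lambda>p. {n. n < X \<and> p\<^sup>2 dvd B + A * n})"
  have fin: "finite Q" by (rule finite_subset[of _ "{..<Z}"]) (auto simp: Q_def)
  have "{n. n < X \<and> (\<exists>p. prime p \<and> p\<^sup>2 dvd B + A * n)} \<subseteq> (\<Union>p\<in>Q. S p)"
  proof clarify
    fix n p assume n: "n < X" and p: "prime p" "p\<^sup>2 dvd B + A * n"
    have "p dvd B + A * n" using p(2) by (auto simp: power2_eq_square intro: dvd_mult_left)
    then have "\<not> p dvd W" using cop[of n] p(1) by (metis coprime_common_divisor_nat prime_nat_iff less_irrefl)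
    moreover have "p\<^sup>2 < Z\<^sup>2" using Z(1)[OF n] dvd_imp_le[OF p(2) Z(2)] by simp
    then have "p < Z" by (rule power_less_imp_less_base) simp
    ultimately have "p \<in> Q" using W(1)[of p] p(1) by (auto simp: Q_def not_le[symmetric])
    then show "n \<in> (\<Union>p\<in>Q. S p)" using n p by (auto simp: S_def)
  qed
  then have "card {n. n < X \<and> (\<exists>p. prime p \<and> p\<^sup>2 dvd B + A * n)} \<le> card (\<Union>p\<in>Q. S p)"
    using fin by (intro card_mono) (auto simp: S_def)
  also have "\<dots> \<le> (\<Sum>p\<in>Q. card (S p))" using fin by (rule card_UN_le)
  finally have "real (card {n. n < X \<and> (\<exists>p. prime p \<and> p\<^sup>2 dvd B + A * n)}) \<le> real (\<Sum>p\<in>Q. card (S p))"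
    by (rule of_nat_mono)
  also have "\<dots> = (\<Sum>p\<in>Q. real (card (S p)))" by simp
  also have "\<dots> \<le> (\<Sum>p\<in>Q. real X * (1 / (real p)\<^sup>2) + 1)"
  proof (rule sum_mono)
    fix p assume p: "p \<in> Q"
    then have "\<not> p dvd A" using W(2) by (auto simp: Q_def dest: dvd_trans)
    then have "coprime p A" using p by (auto simp: Q_def intro: prime_imp_coprime)
    then have "coprime A (p\<^sup>2)" by (simp add: coprime_commute)
    then show "real (card (S p)) \<le> real X * (1 / (real p)\<^sup>2) + 1"
      using card_dvd_linear(1)[of A "p\<^sup>2" X B] p by (auto simp: S_def Q_def prime_gt_0_nat)
  qed
  also have "\<dots> = real X * (\<Sum>p\<in>Q. 1 / (real p)\<^sup>2) + real (card Q)"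
    by (simp add: sum.distrib sum_distrib_left)
  also have "\<dots> \<le> real X * (1 / real k) + real Z"
  proof (intro add_mono mult_left_mono)
    show "(\<Sum>p\<in>Q. 1 / (real p)\<^sup>2) \<le> 1 / real k"
      using fin k by (intro sum_inverse_squares_le) (auto simp: Q_def)
    have "card Q \<le> card {..<Z}" by (intro card_mono) (auto simp: Q_def)
    then show "real (card Q) \<le> real Z" by simp
  qed auto
  finally show ?thesis by simp
qed

section \<open>Pigeonhole among the forms\<close>

text \<open>Double counting: on average over \<open>n\<close>, at most a quarter of the
  \<open>k\<close> indices are bad, and some \<open>n\<close> is no worse than the average.\<close>

lemma exists_small_fibre_count:
  fixes bad :: "nat \<Rightarrow> nat set"
  assumes X: "X > 0" and sub: "\<And>l. l < k \<Longrightarrow> bad l \<subseteq> {..<X}"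
    and bad: "\<And>l. l < k \<Longrightarrow> 4 * real (card (bad l)) \<le> real X"
  shows "\<exists>n<X. 4 * card {l. l < k \<and> n \<in> bad l} \<le> k"
proof (rule ccontr)
  assume neg: "\<not> ?thesis"
  have "4 * (\<Sum>l<k. card (bad l)) = 4 * (\<Sum>l<k. \<Sum>n<X. of_bool (n \<in> bad l))"
  proof -
    have "card (bad l) = (\<Sum>n<X. of_bool (n \<in> bad l))" if "l < k" for l
    proof -
      have "bad l = {..<X} \<inter> bad l" using sub[OF that] by blast
      then show ?thesis by simp
    qed
    then show ?thesis by simp
  qed
  also have "\<dots> = (\<Sum>n<X. 4 * (\<Sum>l<k. of_bool (n \<in> bad l)))"
    by (subst sum.swap) (simp add: sum_distrib_left)
  also have "\<dots> = (\<Sum>n<X. 4 * card {l. l < k \<and> n \<in> bad l})"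
  proof -
    have "{..<k} \<inter> {l. n \<in> bad l} = {l. l < k \<and> n \<in> bad l}" for n by auto
    then show ?thesis by simp
  qed
  finally have eq: "4 * (\<Sum>l<k. card (bad l)) = (\<Sum>n<X. 4 * card {l. l < k \<and> n \<in> bad l})" .
  have "(\<Sum>n<X. k + 1) \<le> (\<Sum>n<X. 4 * card {l. l < k \<and> n \<in> bad l})"
    using neg by (intro sum_mono) force
  then have "X * (k + 1) \<le> 4 * (\<Sum>l<k. card (bad l))" unfolding eq by simp
  then have "real (X * (k + 1)) \<le> real (4 * (\<Sum>l<k. card (bad l)))" by (rule of_nat_mono)
  also have "\<dots> = (\<Sum>l<k. 4 * real (card (bad l)))" by (simp add: sum_distrib_left)
  also have "\<dots> \<le> (\<Sum>l<k. real X)" using bad by (intro sum_mono) auto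
  finally have "X * (k + 1) \<le> k * X" by (simp flip: of_nat_mult of_nat_add of_nat_Suc)
  then show False using X by simp
qed

text \<open>Six primes above \<open>y\<close> would already multiply to at least
  \<open>y ^ 6\<close>. Counting only primes up to \<open>y\<close> thus loses at most 5, and lets
  \<open>turan_kubilius\<close> run over a set of primes that is small compared with the range of
  \<open>n\<close>.\<close>

lemma card_prime_factors_bounds:
  fixes L y W :: nat
  assumes L: "0 < L" "L < y ^ 6" "coprime L W" and y: "y > 1"
  defines "w \<equiv> card {p \<in> {p. prime p \<and> p \<le> y \<and> \<not> p dvd W}. p dvd L}"
  shows "w \<le> card (prime_factors L)" "card (prime_factors L) \<le> w + 5"
proof -
  define S where "S = {p \<in> {p. prime p \<and> p \<le> y \<and> \<not> p dvd W}. p dvd L}"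
  define R where "R = {p \<in> prime_factors L. y < p}"
  have fin: "finite S" "finite R"
    by (auto simp: S_def R_def intro: finite_subset[of _ "{..y}"])
  have "\<not> p dvd W" if "prime p" "p dvd L" for p
    using L(3) that by (metis coprime_common_divisor_nat prime_nat_iff less_irrefl)
  then have "prime_factors L = S \<union> R"
    using L(1) by (auto simp: S_def R_def prime_factors_dvd)
  moreover have "S \<inter> R = {}" by (auto simp: S_def R_def)
  ultimately have c: "card (prime_factors L) = card S + card R"
    using fin by (simp add: card_Un_disjoint)
  have "\<Prod>R dvd L" using fin by (intro prod_primes_dvd) (auto simp: R_def)
  then have "\<Prod>R \<le> L" using L by (intro dvd_imp_le)
  moreover have "y ^ card R \<le> \<Prod>R" using fin by (intro power_card_le_prod) (auto simp: R_def)
  ultimately have "y ^ card R < y ^ 6" using L by linarith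
  then have "card R < 6" using y by simp
  then show "w \<le> card (prime_factors L)" "card (prime_factors L) \<le> w + 5"
    using c by (auto simp: w_def S_def)
qed

text \<open>The reciprocals of the primes up to \<open>y\<close> sum to at most
  \<open>2 * t^2 + 1\<close>, so the numbers of prime factors typically fluctuate by
  \<open>O(t)\<close> only, while \<open>20 * t\<close> forms compete. Two squarefree values with
  equally many prime factors have equal divisor counts.\<close>

lemma equal_divisor_counts:
  fixes t W :: nat and A B :: "nat \<Rightarrow> nat"
  defines "y \<equiv> 2 ^ (2 ^ (t\<^sup>2))"
  assumes t: "t \<ge> 3"
    and W: "0 < W" "W \<le> y" "\<And>p. prime p \<Longrightarrow> p \<le> 20 * t \<Longrightarrow> p dvd W"
    and A: "\<And>l. l < 20 * t \<Longrightarrow> A l dvd W"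
    and B: "\<And>l. l < 20 * t \<Longrightarrow> B l \<le> y\<^sup>2"
    and cop: "\<And>l n. l < 20 * t \<Longrightarrow> coprime (B l + A l * n) W"
  shows "\<exists>n\<ge>y. \<exists>i j. i < j \<and> j < 20 * t \<and>
    divisor_count (B i + A i * n) = divisor_count (B j + A j * n)"
proof -
  define k where "k = 20 * t"
  \<comment> \<open>Large enough to absorb the error \<open>3 * (card P)^2\<close> and the term
    \<open>Z = y ^ 3\<close> of the square count, small enough to keep all values below
    \<open>y ^ 6\<close>.\<close>
  define X where "X = y ^ 4"
  \<comment> \<open>\<open>T^2\<close> is \<open>16 * (t + 1)^2\<close>, whereas the variance is at
    most \<open>2 * (t + 1)^2\<close> per integer; hence at most one eighth of the \<open>n\<close>
    deviate by more than \<open>T\<close>.\<close>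
  define T where "T = 4 * t + 4"
  \<comment> \<open>Starting the argument at \<open>X\<close> rather than 0 makes the integer found
    at least \<open>y\<close>.\<close>
  define L where "L = (\<lambda>l n. B l + A l * (X + n))"
  have "(16::nat) = 2 ^ (2 ^ 2)" by simp
  also have "\<dots> \<le> 2 ^ (2 ^ (t\<^sup>2))"
    using t by (intro power_increasing) (auto simp: power2_eq_square intro: order_trans[OF _ mult_le_mono[of 2 t 2 t]])
  finally have y16: "y \<ge> 16" by (simp add: y_def)
  have L_alt: "L l n = (B l + A l * X) + A l * n" for l n by (simp add: L_def algebra_simps)
  have copL: "coprime (L l n) W" if "l < k" for l n
    using cop that by (simp add: L_def k_def)
  have L_pos: "L l n > 0" if "l < k" for l n
  proof (rule ccontr)
    assume "\<not> L l n > 0"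
    then have "W = 1" using copL[OF that, of n] by simp
    then show False using W(3)[of 2] t two_is_prime_nat by simp
  qed
  have L_less: "L l n < y ^ 6" if "l < k" "n < X" for l n
  proof -
    have "A l \<le> y" using A[of l] W that by (auto simp: k_def dest!: dvd_imp_le)
    then have "L l n \<le> y\<^sup>2 + y * (2 * y ^ 4)"
      unfolding L_def using B[of l] that by (intro add_mono mult_mono) (auto simp: X_def k_def)
    also have "y\<^sup>2 \<le> y ^ 5" using y16 by (intro power_increasing) auto
    finally have "L l n \<le> 3 * y ^ 5" by (simp add: eval_nat_numeral algebra_simps)
    also have "\<dots> < y * y ^ 5" using y16 by (intro mult_strict_right_mono) auto
    also have "\<dots> = y ^ 6" by (simp add: eval_nat_numeral)
    finally show ?thesis .
  qed
  define P where "P = {p. prime p \<and> p \<le> y \<and> \<not> p dvd W}"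
  have finP: "finite P" by (rule finite_subset[of _ "{..y}"]) (auto simp: P_def)
  define M where "M = (\<Sum>p\<in>P. 1 / real p)"
  define w where "w = (\<lambda>l n. card {p \<in> P. p dvd L l n})"
  have "M \<le> prime_recip_sum y"
    unfolding M_def prime_recip_sum_def by (intro sum_mono2) (auto simp: P_def)
  also have "\<dots> \<le> 2 * real (t\<^sup>2) + 1" unfolding y_def by (rule prime_recip_sum_le)
  finally have M: "M \<le> 2 * real (t\<^sup>2) + 1" .
  define sq where "sq = (\<lambda>l. {n. n < X \<and> (\<exists>p. prime p \<and> p\<^sup>2 dvd L l n)})"
  define dev where "dev = (\<lambda>l. {n. n < X \<and> real T < \<bar>real (w l n) - M\<bar>})"
  have sq: "8 * real (card (sq l)) \<le> real X" if l: "l < k" for l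
  proof -
    have "real (card (sq l)) \<le> real X / real k + real (y ^ 3)"
      unfolding sq_def L_alt
    proof (rule card_square_divisible_le)
      show "B l + A l * X + A l * n < (y ^ 3)\<^sup>2" if "n < X" for n
        using L_less[OF l that] by (simp add: L_alt power_mult[symmetric])
      show "coprime (B l + A l * X + A l * n) W" "B l + A l * X + A l * n > 0" for n
        using copL[OF l, of n] L_pos[OF l, of n] by (simp_all only: L_alt)
    qed (use W A l t in \<open>auto simp: k_def\<close>)
    moreover have "real X / real k \<le> real X / 16"
      using t by (intro divide_left_mono) (auto simp: k_def)
    moreover have "16 * y ^ 3 \<le> y * y ^ 3" using y16 by (intro mult_right_mono) auto
    then have "16 * y ^ 3 \<le> X" by (simp add: X_def eval_nat_numeral)
    then have "real (16 * y ^ 3) \<le> real X" by (rule of_nat_mono)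
    then have "16 * real (y ^ 3) \<le> real X" by simp
    ultimately show ?thesis by linarith
  qed
  have dev: "8 * real (card (dev l)) \<le> real X" if l: "l < k" for l
  proof -
    have "coprime (A l) p" if "p \<in> P" for p
    proof -
      have "\<not> p dvd A l" using A[of l] l that by (auto simp: P_def k_def dest: dvd_trans)
      then show ?thesis using that by (auto simp: P_def coprime_commute intro: prime_imp_coprime)
    qed
    then have "(real T)\<^sup>2 * real (card (dev l)) \<le> real X * M + 3 * (real (card P))\<^sup>2"
      using card_large_deviation_le[OF finP, of "A l" "real T" X "B l + A l * X"]
      by (simp add: dev_def w_def L_alt M_def P_def)
    also have "3 * (real (card P))\<^sup>2 \<le> real X * 1"
    proof -
      have "P \<subseteq> {1..y}" by (auto simp: P_def prime_gt_0_nat Suc_le_eq)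
      then have "card P \<le> card {1..y}" by (intro card_mono) auto
      then have "card P \<le> y" by simp
      then have "3 * (card P)\<^sup>2 \<le> y\<^sup>2 * y\<^sup>2"
        using y16 by (intro mult_mono power_mono) (auto simp: power2_eq_square intro: order_trans[OF _ mult_le_mono[of 2 y 2 y]])
      then have "3 * (card P)\<^sup>2 \<le> X" by (simp add: X_def power2_eq_square eval_nat_numeral mult.assoc)
      then have "real (3 * (card P)\<^sup>2) \<le> real X" by (rule of_nat_mono)
      then show ?thesis by simp
    qed
    finally have "(real T)\<^sup>2 * real (card (dev l)) \<le> real X * (M + 1)" by (simp add: algebra_simps)
    also have "\<dots> \<le> real X * (2 * (real t + 1)\<^sup>2)"
      using M by (intro mult_left_mono) (auto simp: power2_eq_square algebra_simps)
    finally have "(real t + 1)\<^sup>2 * (8 * real (card (dev l))) \<le> (real t + 1)\<^sup>2 * real X"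
      by (simp add: T_def power2_eq_square algebra_simps)
    then show ?thesis by (rule mult_left_le_imp_le) (simp add: add_pos_pos power2_eq_square)
  qed
  have "\<exists>n<X. 4 * card {l. l < k \<and> n \<in> sq l \<union> dev l} \<le> k"
  proof (rule exists_small_fibre_count)
    show "4 * real (card (sq l \<union> dev l)) \<le> real X" if "l < k" for l
    proof -
      have "real (card (sq l \<union> dev l)) \<le> real (card (sq l)) + real (card (dev l))"
        using card_Un_le[of "sq l" "dev l"] by linarith
      then show ?thesis using sq[OF that] dev[OF that] by linarith
    qed
  qed (use y16 in \<open>auto simp: sq_def dev_def X_def\<close>)
  then obtain n where n: "n < X" "4 * card {l. l < k \<and> n \<in> sq l \<union> dev l} \<le> k" by blast
  define G where "G = {l. l < k \<and> n \<notin> sq l \<union> dev l}"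
  have "card {..<k} = card (G \<union> {l. l < k \<and> n \<in> sq l \<union> dev l})"
    by (rule arg_cong[of _ _ card]) (auto simp: G_def)
  also have "\<dots> \<le> card G + card {l. l < k \<and> n \<in> sq l \<union> dev l}" by (rule card_Un_le)
  finally have cardG: "15 * t \<le> card G" using n(2) by (simp add: k_def)
  \<comment> \<open>The least natural number within \<open>T\<close> below \<open>M\<close>, cut off
    at 0 when \<open>M < T\<close>.\<close>
  define m0 where "m0 = nat \<lceil>M - real T\<rceil>"
  define \<Omega> where "\<Omega> = (\<lambda>l. card (prime_factors (L l n)))"
  have range: "\<Omega> ` G \<subseteq> {m0..m0 + 2 * T + 5}"
  proof (rule image_subsetI)
    fix l assume "l \<in> G"
    then have l: "l < k" and d: "\<bar>real (w l n) - M\<bar> \<le> real T"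
      using n(1) by (auto simp: G_def dev_def)
    have "m0 \<le> w l n" using d by (simp add: m0_def nat_ceiling_le_eq)
    moreover have "M - real T \<le> real m0" by (simp add: m0_def real_nat_ceiling_ge)
    then have "real (w l n) \<le> real (m0 + 2 * T)" using d by simp
    then have "w l n \<le> m0 + 2 * T" by (simp only: of_nat_le_iff)
    moreover have "w l n \<le> \<Omega> l" "\<Omega> l \<le> w l n + 5"
      unfolding w_def P_def \<Omega>_def
      using card_prime_factors_bounds[OF L_pos[OF l] L_less[OF l n(1)] copL[OF l]] y16 by auto
    ultimately show "\<Omega> l \<in> {m0..m0 + 2 * T + 5}" by auto
  qed
  \<comment> \<open>At least \<open>15 * t\<close> good indices share
    \<open>2 * T + 6 = 8 * t + 14\<close> possible values, which are fewer as soon as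
    \<open>t >= 3\<close>.\<close>
  have "\<not> inj_on \<Omega> G"
  proof
    assume "inj_on \<Omega> G"
    then have "card G \<le> card {m0..m0 + 2 * T + 5}" using range by (intro card_inj_on_le[of \<Omega>]) auto
    then show False using cardG t by (simp add: T_def)
  qed
  then obtain i j where ij: "i \<in> G" "j \<in> G" "i \<noteq> j" "\<Omega> i = \<Omega> j" by (auto simp: inj_on_def)
  have dc: "divisor_count (L l n) = 2 ^ \<Omega> l" if "l \<in> G" for l
    unfolding \<Omega>_def using that n(1) L_pos[of l n]
    by (intro divisor_count_squarefree) (auto simp: G_def sq_def)
  have "divisor_count (L i n) = divisor_count (L j n)" using ij dc by simp
  moreover have "y \<le> X + n"
    using y16 power_increasing[of 1 4 y] by (simp add: X_def)
  moreover have "i < k" "j < k" using ij by (auto simp: G_def)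
  ultimately show ?thesis
    using ij(3) unfolding k_def[symmetric] L_def by (metis linorder_neqE_nat)
qed

section \<open>Shifts with prescribed differences\<close>

lemma ex_shift_cong_nat: "\<exists>r. [r + c = d] (mod m)" if "m > 0" for c d m :: nat
proof -
  have "d + (m - 1) * c + c = d + m * c" using that by (cases m) auto
  then have "((d + (m - 1) * c) + c) mod m = (d + m * c) mod m" by (simp only:)
  then have "[(d + (m - 1) * c) + c = d] (mod m)" by (simp add: cong_def)
  then show ?thesis by blast
qed

lemma multiplicity_cong_nat:
  fixes p x y :: nat
  assumes "[x = y] (mod p ^ Suc n)" "p ^ n dvd y" "\<not> p ^ Suc n dvd y"
  shows "multiplicity p x = n"
proof (rule multiplicity_eqI)
  have "[x = y] (mod p ^ n)"
    using assms(1) by (rule cong_dvd_mono_modulus) (simp add: le_imp_power_dvd)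
  then show "p ^ n dvd x" using assms(2) cong_dvd_iff by blast
  show "\<not> p ^ Suc n dvd x" using assms(1,3) cong_dvd_iff by blast
qed

lemma ex_residue_avoiding:
  fixes h :: "nat \<Rightarrow> nat"
  assumes "m < p"
  shows "\<exists>r. \<forall>l<m. \<not> [r = h l] (mod p)"
proof -
  have "card ((\<lambda>l. h l mod p) ` {..<m}) \<le> m"
    using card_image_le[of "{..<m}" "\<lambda>l. h l mod p"] by simp
  then have "card ((\<lambda>l. h l mod p) ` {..<m}) < card {..<p}" using assms by simp
  then obtain r where "r \<in> {..<p}" "r \<notin> (\<lambda>l. h l mod p) ` {..<m}"
    by (metis card_mono finite_imageI finite_lessThan not_le subsetI)
  then have "\<forall>l<m. \<not> [r = h l] (mod p)" by (auto simp: cong_def)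
  then show ?thesis by blast
qed

text \<open>The sequence is built greedily: outside \<open>F\<close>, each new term avoids the residues of all
  earlier terms modulo every prime that already divides a difference.\<close>

lemma separated_sequence:
  fixes F :: "nat set" and f :: "nat \<Rightarrow> nat" and c :: "nat \<Rightarrow> nat \<Rightarrow> nat"
  assumes F: "finite F" "\<And>p. p \<in> F \<Longrightarrow> prime p" "\<And>p. prime p \<Longrightarrow> p \<le> k \<Longrightarrow> p \<in> F"
  defines "Q \<equiv> (\<Prod>p\<in>F. p ^ f p)"
  assumes "m \<le> k"
  shows "\<exists>h. (\<forall>l<m. \<forall>p\<in>F. [h l = c p l] (mod p ^ f p)) \<and> (\<forall>j<m. \<forall>i<j. h i < h j) \<and>
    (\<forall>p i j i' j'. prime p \<longrightarrow> p \<notin> F \<longrightarrow> i < j \<longrightarrow> j < m \<longrightarrow> i' < j' \<longrightarrow> j' < m \<longrightarrow>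
      [h i = h j] (mod p) \<longrightarrow> [h i' = h j'] (mod p) \<longrightarrow> i = i' \<and> j = j') \<and>
    (\<forall>l<m. h l \<le> (4 * Q) ^ ((k\<^sup>2 + 1) ^ m))"
  using \<open>m \<le> k\<close>
proof (induction m)
  case 0
  then show ?case by auto
next
  case (Suc m)
  define B where "B = (4 * Q) ^ ((k\<^sup>2 + 1) ^ m)"
  obtain h where h: "(\<forall>l<m. \<forall>p\<in>F. [h l = c p l] (mod p ^ f p)) \<and> (\<forall>j<m. \<forall>i<j. h i < h j) \<and>
    (\<forall>p i j i' j'. prime p \<longrightarrow> p \<notin> F \<longrightarrow> i < j \<longrightarrow> j < m \<longrightarrow> i' < j' \<longrightarrow> j' < m \<longrightarrow>
      [h i = h j] (mod p) \<longrightarrow> [h i' = h j'] (mod p) \<longrightarrow> i = i' \<and> j = j') \<and>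
    (\<forall>l<m. h l \<le> B)"
    using Suc.IH[OF Suc_leD[OF Suc.prems]] unfolding B_def[symmetric] by (elim exE)
  then have h1: "\<And>l p. l < m \<Longrightarrow> p \<in> F \<Longrightarrow> [h l = c p l] (mod p ^ f p)"
    and h2: "\<And>i j. j < m \<Longrightarrow> i < j \<Longrightarrow> h i < h j"
    and h3: "\<And>p i j i' j'. prime p \<Longrightarrow> p \<notin> F \<Longrightarrow> i < j \<Longrightarrow> j < m \<Longrightarrow> i' < j' \<Longrightarrow> j' < m \<Longrightarrow>
      [h i = h j] (mod p) \<Longrightarrow> [h i' = h j'] (mod p) \<Longrightarrow> i = i' \<and> j = j'"
    and h4: "\<And>l. l < m \<Longrightarrow> h l \<le> B"
    by simp_all
  have Q: "Q > 0" unfolding Q_def using F by (auto intro!: prod_pos simp: prime_gt_0_nat)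
  then have B: "B > 0" by (simp add: B_def)
  define I where "I = {(i, j). i < j \<and> j < m}"
  have I_sub: "I \<subseteq> {..<m} \<times> {..<m}" by (auto simp: I_def)
  then have finI: "finite I" by (rule finite_subset) auto
  have cardI: "card I \<le> m * m" using card_mono[OF _ I_sub] by simp
  \<comment> \<open>Every prime at which two earlier terms collide divides \<open>D\<close>, so the
    bound on \<open>D\<close> also bounds the product of the new moduli.\<close>
  define D where "D = (\<Prod>(i, j)\<in>I. h j - h i)"
  have D_pos: "D > 0" unfolding D_def by (rule prod_pos) (auto simp: I_def h2)
  have "D \<le> (\<Prod>(i, j)\<in>I. B)"
    unfolding D_def by (rule prod_mono) (auto simp: I_def intro: order_trans[OF diff_le_self h4])
  also have "\<dots> \<le> B ^ (m * m)" using cardI B by (simp add: case_prod_unfold power_increasing)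
  finally have D_le: "D \<le> B ^ (m * m)" .
  define G where "G = {p. prime p \<and> p \<notin> F \<and> p dvd D}"
  have finG: "finite G"
    using D_pos by (intro finite_subset[of G "{..D}"]) (auto simp: G_def dvd_imp_le)
  have G_iff: "p \<in> G" if "prime p" "p \<notin> F" "i < j" "j < m" "[h i = h j] (mod p)" for p i j
  proof -
    have "p dvd h j - h i" using that h2
      by (metis cong_altdef_nat cong_sym less_imp_le)
    also have "h j - h i dvd D" unfolding D_def
      using dvd_prodI[OF finI, of "(i, j)" "\<lambda>(i, j). h j - h i"] that by (auto simp: I_def)
    finally show ?thesis using that by (simp add: G_def)
  qed
  have "\<Prod>G dvd D" using finG by (intro prod_primes_dvd) (auto simp: G_def)
  then have G_le: "\<Prod>G \<le> D" using D_pos by (intro dvd_imp_le)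
  have G_pos: "\<Prod>G > 0" using finG by (auto intro!: prod_pos simp: G_def prime_gt_0_nat)
  have "\<forall>p\<in>G. \<exists>r. \<forall>l<m. \<not> [r = h l] (mod p)"
  proof
    fix p assume "p \<in> G"
    \<comment> \<open>All primes up to \<open>k\<close> lie in \<open>F\<close>; hence
      \<open>p\<close> has more residues than the \<open>m\<close> to be avoided.\<close>
    then have "k < p" using F(3)[of p] by (auto simp: G_def not_le[symmetric])
    then show "\<exists>r. \<forall>l<m. \<not> [r = h l] (mod p)"
      using Suc.prems by (intro ex_residue_avoiding) simp
  qed
  then obtain r where r: "\<And>p l. p \<in> G \<Longrightarrow> l < m \<Longrightarrow> \<not> [r p = h l] (mod p)" by metis
  define M where "M = (\<lambda>p. if p \<in> F then p ^ f p else p)"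
  define u where "u = (\<lambda>p. if p \<in> F then c p m else r p)"
  have FG: "F \<inter> G = {}" by (auto simp: G_def)
  have "\<exists>!x. x < (\<Prod>p\<in>F \<union> G. M p) \<and> (\<forall>p\<in>F \<union> G. [x = u p] (mod M p))"
  proof (rule chinese_remainder_unique_nat)
    show "\<forall>p\<in>F \<union> G. M p \<noteq> 0" using F(2) by (auto simp: M_def G_def prime_gt_0_nat)
    show "\<forall>p\<in>F \<union> G. \<forall>q\<in>F \<union> G. p \<noteq> q \<longrightarrow> coprime (M p) (M q)"
    proof (intro ballI impI)
      fix p q assume "p \<in> F \<union> G" "q \<in> F \<union> G" "p \<noteq> q"
      then have "coprime p q" using F(2) by (intro primes_coprime) (auto simp: G_def)
      then show "coprime (M p) (M q)" by (simp add: M_def)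
    qed
  qed (use F finG in auto)
  then obtain x where x: "x < (\<Prod>p\<in>F \<union> G. M p)" "\<And>p. p \<in> F \<union> G \<Longrightarrow> [x = u p] (mod M p)"
    by blast
  define R where "R = (\<Prod>p\<in>F \<union> G. M p)"
  have "R = (\<Prod>p\<in>F. M p) * (\<Prod>p\<in>G. M p)"
    unfolding R_def using F finG FG by (intro prod.union_disjoint) auto
  also have "(\<Prod>p\<in>F. M p) = Q" by (simp add: Q_def M_def)
  also have "(\<Prod>p\<in>G. M p) = \<Prod>G" by (rule prod.cong) (auto simp: M_def G_def)
  finally have R: "R = Q * \<Prod>G" .
  have R_le: "R \<le> Q * B ^ (m * m)" unfolding R using G_le D_le by (intro mult_left_mono) auto
  have R_pos: "R > 0" using R Q G_pos by simp
  \<comment> \<open>The solution \<open>x\<close> matters only modulo \<open>R\<close>; adding a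
    multiple of \<open>R\<close> lifts it beyond \<open>B\<close> and so beyond all earlier
    terms.\<close>
  define z where "z = x + R * (B + 1)"
  have z_cong: "[z = u p] (mod M p)" if "p \<in> F \<union> G" for p
  proof -
    have "M p dvd R" unfolding R_def using that F finG by (intro dvd_prodI) auto
    then obtain d where "R = M p * d" ..
    then have "z = x + M p * (d * (B + 1))" unfolding z_def by (simp only: mult.assoc)
    then have "[z = x] (mod M p)" by (simp only: cong_def mod_mult_self2)
    then show ?thesis using x(2)[OF that] by (rule cong_trans)
  qed
  have "B < R * (B + 1)" using R_pos by (cases R) auto
  then have z_gt: "B < z" by (simp add: z_def)
  have "z \<le> R * 1 + R * (B + 1)" using x(1) by (simp add: z_def R_def)
  also have "\<dots> = R * (B + 2)" by (simp add: algebra_simps)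
  also have "\<dots> \<le> (Q * B ^ (m * m)) * (4 * B)" using R_le B by (intro mult_mono) auto
  also have "\<dots> = (4 * Q) * B ^ (m * m + 1)" by simp
  \<comment> \<open>One step multiplies the exponent of \<open>4 * Q\<close> by at most
    \<open>k^2 + 1\<close>.\<close>
  also have "\<dots> \<le> (4 * Q) * B ^ (k\<^sup>2)"
  proof (intro mult_left_mono power_increasing)
    have "m * m + 1 \<le> (m + 1) * (m + 1)" by simp
    also have "\<dots> \<le> k * k" using Suc.prems by (intro mult_mono) auto
    finally show "m * m + 1 \<le> k\<^sup>2" by (simp add: power2_eq_square)
  qed (use B in auto)
  also have "\<dots> = (4 * Q) ^ (1 + (k\<^sup>2 + 1) ^ m * k\<^sup>2)"
    by (simp only: B_def power_mult power_add power_one_right)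
  also have "\<dots> \<le> (4 * Q) ^ ((k\<^sup>2 + 1) ^ Suc m)"
    using Q by (intro power_increasing) (auto simp: algebra_simps)
  finally have z_le: "z \<le> (4 * Q) ^ ((k\<^sup>2 + 1) ^ Suc m)" .
  have B_le: "B \<le> (4 * Q) ^ ((k\<^sup>2 + 1) ^ Suc m)"
    unfolding B_def using Q by (intro power_increasing) auto
  have new: "\<not> [z = h i] (mod p)" if "p \<in> G" "i < m" for p i
  proof -
    have "[z = r p] (mod p)" using z_cong[of p] that by (auto simp: u_def M_def G_def)
    then show ?thesis using r[OF that] by (metis cong_sym cong_trans)
  qed
  define h' where "h' = h(m := z)"
  have "[h' l = c p l] (mod p ^ f p)" if "l < Suc m" "p \<in> F" for l p
    using that h1[of l p] z_cong[of p] by (cases "l = m") (auto simp: h'_def u_def M_def)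
  moreover have "h' i < h' j" if "j < Suc m" "i < j" for i j
    using that h2[of j i] h4[of i] z_gt by (cases "j = m") (auto simp: h'_def)
  moreover have "h' l \<le> (4 * Q) ^ ((k\<^sup>2 + 1) ^ Suc m)" if "l < Suc m" for l
    using that h4[of l] B_le z_le by (cases "l = m") (auto simp: h'_def)
  moreover have "i = i' \<and> j = j'"
    if p: "prime p" "p \<notin> F" and ij: "i < j" "j < Suc m" "i' < j'" "j' < Suc m"
      and cong: "[h' i = h' j] (mod p)" "[h' i' = h' j'] (mod p)" for p i j i' j'
  proof -
    have G: "p \<in> G" if "i < j" "j < m" "[h' i = h' j] (mod p)" for i j
      using that G_iff[OF p, of i j] by (auto simp: h'_def)
    have nm: "\<not> [h' i = h' m] (mod p)" if "p \<in> G" "i < m" for i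
      using new[OF that] that by (auto simp: h'_def cong_sym_eq)
    consider "j < m" "j' < m" | "j = m" "j' < m" | "j < m" "j' = m" | "j = m" "j' = m"
      using ij by linarith
    then show ?thesis
    proof cases
      case 1
      then show ?thesis using h3[OF p, of i j i' j'] ij cong by (auto simp: h'_def)
    next
      case 2
      then show ?thesis using G[of i' j'] nm[of i] ij cong by auto
    next
      case 3
      then show ?thesis using G[of i j] nm[of i'] ij cong by auto
    next
      case 4
      \<comment> \<open>Both pairs end in the new term, so \<open>h' i\<close> and
        \<open>h' i'\<close> agree modulo \<open>p\<close>. If \<open>i\<close> and
        \<open>i'\<close> differed, \<open>p\<close> would lie in \<open>G\<close>, and
        \<open>z\<close> avoids the earlier residues modulo such primes.\<close>
      then have im: "i < m" "i' < m" using ij by auto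
      have *: "[h' i = h' i'] (mod p)" using cong 4 by (metis cong_sym cong_trans)
      have "i = i'"
      proof (rule ccontr)
        assume "i \<noteq> i'"
        then consider "i < i'" | "i' < i" by linarith
        then have "p \<in> G" using G[of i i'] G[of i' i] im * by cases (auto simp: cong_sym_eq)
        then show False using nm[of i] im cong 4 by auto
      qed
      then show ?thesis using 4 by simp
    qed
  qed
  ultimately show ?case by (intro exI[of _ h']) blast
qed

lemma cong_power_dvd_iff_nat:
  fixes p x y :: nat
  assumes "[x = y] (mod p ^ m)" "n \<le> m"
  shows "p ^ n dvd x \<longleftrightarrow> p ^ n dvd y"
  using assms cong_dvd_iff cong_dvd_mono_modulus le_imp_power_dvd by blast

lemma cong_iff_dvd_diff_le: "m \<le> n \<Longrightarrow> [m = n] (mod p) \<longleftrightarrow> p dvd n - m" for m n p :: nat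
  by (metis cong_altdef_nat cong_sym)

lemma prod_power_le_power2:
  fixes S :: "nat set"
  assumes "finite S" "\<And>p. p \<in> S \<Longrightarrow> p \<le> 2 ^ R" "\<And>p. p \<in> S \<Longrightarrow> f p \<le> E" "card S \<le> C"
  shows "(\<Prod>p\<in>S. p ^ f p) \<le> 2 ^ (C * R * E)"
proof -
  have "(\<Prod>p\<in>S. p ^ f p) \<le> (\<Prod>p\<in>S. (2 ^ R) ^ E)"
  proof (rule prod_mono)
    fix p assume p: "p \<in> S"
    have "p ^ f p \<le> (2 ^ R) ^ f p" using assms(2)[OF p] by (rule power_mono) simp
    also have "\<dots> \<le> (2 ^ R) ^ E" using assms(3)[OF p] by (intro power_increasing) auto
    finally show "0 \<le> p ^ f p \<and> p ^ f p \<le> (2 ^ R) ^ E" by simp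
  qed
  also have "\<dots> = 2 ^ (R * E * card S)" by (simp add: power_mult)
  also have "\<dots> \<le> 2 ^ (R * E * C)" using assms(4) by (intro power_increasing mult_le_mono) auto
  finally show ?thesis by (simp add: mult_ac)
qed

text \<open>The residues \<open>p ^ l\<close> give the shifts distinct exponents at
  \<open>p\<close>, so a difference inherits the smaller one. This is the minimum that
  \<open>consecutive_of_design\<close> asks for.\<close>

lemma multiplicity_diff_small_prime:
  fixes p k i j x y :: nat
  assumes "prime p" "[x = p ^ i] (mod p ^ k)" "[y = p ^ j] (mod p ^ k)" "i < j" "j < k" "x < y"
  shows "multiplicity p (y - x) = i"
proof (rule multiplicity_eqI)
  have p1: "p > 1" using prime_gt_1_nat assms(1) by blast
  have "p ^ i dvd x" "p ^ i dvd y"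
    using cong_power_dvd_iff_nat[OF assms(2), of i] cong_power_dvd_iff_nat[OF assms(3), of i] assms(4,5)
    by (auto simp: le_imp_power_dvd)
  then show "p ^ i dvd y - x" by (rule dvd_diff_nat[rotated])
  have "p ^ Suc i dvd p ^ j" using assms(4) by (intro le_imp_power_dvd) simp
  moreover have "\<not> p ^ Suc i dvd p ^ i" using p1 by (auto dest: power_dvd_imp_le)
  ultimately have "p ^ Suc i dvd y" "\<not> p ^ Suc i dvd x"
    using cong_power_dvd_iff_nat[OF assms(2), of "Suc i"] cong_power_dvd_iff_nat[OF assms(3), of "Suc i"]
      assms(4,5) by simp_all
  moreover have "y = (y - x) + x" using assms(6) by simp
  ultimately show "\<not> p ^ Suc i dvd y - x" by (metis dvd_add_right_iff)
qed

text \<open>An instance of \<open>separated_sequence\<close>: primes up to \<open>k\<close> get the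
  residues \<open>p ^ l\<close>, each triple \<open>(i, j, s)\<close> gets a prime of its own with a
  prescribed power in \<open>h j - h i\<close>, and the remaining primes are separated by the greedy
  choice. The factors of \<open>\<Lambda>\<close> bound the number of prescribed primes, the
  logarithm of their size, their exponents, and the growth of the greedy construction.\<close>

lemma design_sequence:
  fixes M :: "nat \<Rightarrow> nat \<Rightarrow> bool \<Rightarrow> nat"
  assumes k: "k > 0" and M: "\<And>i j s. 2 \<le> M i j s" "\<And>i j s. i < j \<Longrightarrow> j < k \<Longrightarrow> M i j s \<le> m"
  defines "\<Lambda> \<equiv> (2 + (k + 1 + 2 * k\<^sup>2) * (2 * k\<^sup>2 + k + 6)\<^sup>2 * (k + m)) * (k\<^sup>2 + 1) ^ k"
  obtains h :: "nat \<Rightarrow> nat" and q :: "nat \<Rightarrow> nat \<Rightarrow> bool \<Rightarrow> nat" where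
    "\<And>i j. i < j \<Longrightarrow> j < k \<Longrightarrow> h i < h j"
    "\<And>p l. prime p \<Longrightarrow> p \<le> k \<Longrightarrow> l < k \<Longrightarrow> [h l = p ^ l] (mod p ^ k)"
    "\<And>p i j i' j'. prime p \<Longrightarrow> k < p \<Longrightarrow> i < j \<Longrightarrow> j < k \<Longrightarrow> i' < j' \<Longrightarrow> j' < k \<Longrightarrow>
      p dvd h j - h i \<Longrightarrow> p dvd h j' - h i' \<Longrightarrow> i = i' \<and> j = j'"
    "\<And>i j s. i < j \<Longrightarrow> j < k \<Longrightarrow> prime (q i j s) \<and> k < q i j s \<and>
      multiplicity (q i j s) (h j - h i) = M i j s - 1"
    "\<And>i j. i < j \<Longrightarrow> j < k \<Longrightarrow> q i j True \<noteq> q i j False"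
    "\<And>l. l < k \<Longrightarrow> h l \<le> 2 ^ \<Lambda>"
proof -
  define I where "I = {(i, j, s :: bool). i < j \<and> j < k}"
  have I_sub: "I \<subseteq> {..<k} \<times> {..<k} \<times> UNIV" by (auto simp: I_def)
  then have finI: "finite I" by (rule finite_subset) auto
  have cardI: "card I \<le> 2 * k\<^sup>2"
    using card_mono[OF _ I_sub] by (simp add: card_cartesian_product power2_eq_square)
  obtain P where P: "finite P" "card P = card I" "\<And>p. p \<in> P \<Longrightarrow> prime p" "P \<inter> {..k} = {}"
    "\<And>p. p \<in> P \<Longrightarrow> p \<le> 2 ^ ((card I + card {..k} + 5)\<^sup>2)"
    using obtain_small_primes[of "{..k}" "card I"] by auto
  obtain qq where qq: "bij_betw qq I P"
    using finite_same_card_bij[OF finI P(1)] P(2) by auto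
  define P0 where "P0 = {p. prime p \<and> p \<le> k}"
  have finP0: "finite P0" by (rule finite_subset[of _ "{..k}"]) (auto simp: P0_def)
  have cardP0: "card P0 \<le> k + 1" using card_mono[of "{..k}" P0] by (auto simp: P0_def)
  define F where "F = P0 \<union> P"
  define ix where "ix = inv_into I qq"
  define f where "f = (\<lambda>p. if p \<le> k then k else case ix p of (i, j, s) \<Rightarrow> M i j s)"
  \<comment> \<open>For the prime of \<open>(i, j, s)\<close> the residues \<open>l < k < p\<close>
    are distinct, except that \<open>j\<close> is moved to \<open>i + p ^ (f p - 1)\<close>. Thus
    \<open>i\<close> and \<open>j\<close> alone coincide modulo \<open>p\<close>, and
    \<open>h j - h i\<close> is exactly divisible by that power.\<close>
  define c where "c = (\<lambda>p l. if p \<le> k then p ^ l else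
    case ix p of (i, j, s) \<Rightarrow> if l = j then i + p ^ (f p - 1) else l)"
  define R where "R = (2 * k\<^sup>2 + k + 6)\<^sup>2"
  define Q where "Q = (\<Prod>p\<in>F. p ^ f p)"
  have ixI: "ix p \<in> I" if "p \<in> P" for p
    using that qq unfolding ix_def by (metis bij_betw_imp_surj_on inv_into_into)
  have ixq: "ix (qq z) = z" if "z \<in> I" for z
    using that qq unfolding ix_def by (metis bij_betw_inv_into_left)
  have "Q \<le> 2 ^ ((k + 1 + 2 * k\<^sup>2) * R * (k + m))"
    unfolding Q_def
  proof (rule prod_power_le_power2)
    show "finite F" using finP0 P by (simp add: F_def)
    show "card F \<le> k + 1 + 2 * k\<^sup>2"
      using card_Un_le[of P0 P] cardP0 cardI P(2) by (simp add: F_def)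
    show "f p \<le> k + m" if "p \<in> F" for p
      using ixI[of p] that M(2) by (auto simp: f_def F_def P0_def I_def split: prod.splits intro: trans_le_add2)
    show "p \<le> 2 ^ R" if "p \<in> F" for p
    proof (cases "p \<in> P")
      case True
      have "(card I + card {..k} + 5)\<^sup>2 \<le> R" unfolding R_def using cardI by (intro power_mono) auto
      then have "(2::nat) ^ ((card I + card {..k} + 5)\<^sup>2) \<le> 2 ^ R" by (intro power_increasing) auto
      then show ?thesis using P(5)[OF True] by linarith
    next
      case False
      then have "p \<le> k" using that by (auto simp: F_def P0_def)
      also have "k \<le> 2 * k\<^sup>2 + k + 6" by simp
      also have "\<dots> \<le> R" unfolding R_def by (rule self_le_power) auto
      also have "R \<le> 2 ^ R" by (simp add: less_imp_le)
      finally show ?thesis .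
    qed
  qed
  then have "4 * Q \<le> 2 ^ 2 * 2 ^ ((k + 1 + 2 * k\<^sup>2) * R * (k + m))" by simp
  then have "(4 * Q) ^ ((k\<^sup>2 + 1) ^ k) \<le> (2 ^ (2 + (k + 1 + 2 * k\<^sup>2) * R * (k + m))) ^ ((k\<^sup>2 + 1) ^ k)"
    by (intro power_mono) (simp_all only: power_add)
  then have Q_le: "(4 * Q) ^ ((k\<^sup>2 + 1) ^ k) \<le> 2 ^ \<Lambda>"
    by (simp only: power_mult[symmetric] \<Lambda>_def R_def)
  have F: "finite F" "\<And>p. p \<in> F \<Longrightarrow> prime p" "\<And>p. prime p \<Longrightarrow> p \<le> k \<Longrightarrow> p \<in> F"
    using finP0 P by (auto simp: F_def P0_def)
  have "\<exists>h. (\<forall>l<k. \<forall>p\<in>F. [h l = c p l] (mod p ^ f p)) \<and> (\<forall>j<k. \<forall>i<j. h i < h j) \<and>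
    (\<forall>p i j i' j'. prime p \<longrightarrow> p \<notin> F \<longrightarrow> i < j \<longrightarrow> j < k \<longrightarrow> i' < j' \<longrightarrow> j' < k \<longrightarrow>
      [h i = h j] (mod p) \<longrightarrow> [h i' = h j'] (mod p) \<longrightarrow> i = i' \<and> j = j') \<and>
    (\<forall>l<k. h l \<le> (4 * Q) ^ ((k\<^sup>2 + 1) ^ k))"
    unfolding Q_def by (rule separated_sequence[where k = k]) (use F in auto)
  then obtain h where h: "(\<forall>l<k. \<forall>p\<in>F. [h l = c p l] (mod p ^ f p)) \<and> (\<forall>j<k. \<forall>i<j. h i < h j) \<and>
    (\<forall>p i j i' j'. prime p \<longrightarrow> p \<notin> F \<longrightarrow> i < j \<longrightarrow> j < k \<longrightarrow> i' < j' \<longrightarrow> j' < k \<longrightarrow>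
      [h i = h j] (mod p) \<longrightarrow> [h i' = h j'] (mod p) \<longrightarrow> i = i' \<and> j = j') \<and>
    (\<forall>l<k. h l \<le> (4 * Q) ^ ((k\<^sup>2 + 1) ^ k))"
    by (elim exE)
  have h_less: "h i < h j" if "i < j" "j < k" for i j using h that by blast
  have hF: "[h l = c p l] (mod p ^ f p)" if "l < k" "p \<in> F" for l p using h that by blast
  have h_gen: "i = i' \<and> j = j'" if "prime p" "p \<notin> F" "i < j" "j < k" "i' < j'" "j' < k"
    "p dvd h j - h i" "p dvd h j' - h i'" for p i j i' j'
    using h that h_less by (meson cong_iff_dvd_diff_le less_imp_le)
  have pair_of_gadget: "i = i0 \<and> j = j0"
    if p: "p \<in> P" "ix p = (i0, j0, s)" and ij: "i < j" "j < k" "p dvd h j - h i" for p i0 j0 s i j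
  proof -
    have p': "prime p" "k < p" "p \<in> F" using p P by (auto simp: F_def)
    have ij0: "i0 < j0" "j0 < k" using ixI[OF p(1)] p(2) by (auto simp: I_def)
    have fp: "f p \<ge> 2" using p' p M(1) by (simp add: f_def)
    \<comment> \<open>The residues modulo \<open>p\<close>: there \<open>p ^ (f p - 1)\<close>
      vanishes because \<open>M\<close> is at least 2.\<close>
    define r where "r = (\<lambda>l. if l = j0 then i0 else l)"
    have r: "[h l = r l] (mod p)" if "l < k" for l
    proof -
      have "p dvd p ^ f p" using fp by (simp add: dvd_power)
      then have "[h l = c p l] (mod p)" using hF[OF that p'(3)] cong_dvd_mono_modulus by blast
      moreover have "p dvd p ^ (f p - 1)" using fp by (simp add: dvd_power)
      then have "[c p l = r l] (mod p)"
        using p' p(2) by (auto simp: c_def r_def cong_def elim!: dvdE)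
      ultimately show ?thesis by (rule cong_trans)
    qed
    have "[h i = h j] (mod p)" using ij h_less[OF ij(1,2)] by (simp add: cong_iff_dvd_diff_le)
    then have "[r i = r j] (mod p)" using r[of i] r[of j] ij by (meson cong_sym cong_trans less_trans)
    moreover have "r i < p" "r j < p" using ij ij0 p' by (auto simp: r_def)
    ultimately have "r i = r j" by (rule cong_less_modulus_unique_nat)
    then show ?thesis using ij ij0 by (auto simp: r_def split: if_splits)
  qed
  have gadget: "multiplicity p (h j - h i) = M i j s - 1"
    if p: "p \<in> P" "ix p = (i, j, s)" for p i j s
  proof -
    have p': "prime p" "k < p" "p \<in> F" using p P by (auto simp: F_def)
    have ij: "i < j" "j < k" using ixI[OF p(1)] p(2) by (auto simp: I_def)
    have fp: "f p = M i j s" using p' p by (simp add: f_def)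
    define n where "n = M i j s - 1"
    have n: "f p = Suc n" using fp M(1)[of i j s] by (simp add: n_def)
    have "[h j = i + p ^ n] (mod p ^ Suc n)" "[h i = i] (mod p ^ Suc n)"
      using hF[of j p] hF[of i p] ij p' p(2) n by (auto simp: c_def)
    then have "[(h j - h i) + h i = p ^ n + h i] (mod p ^ Suc n)"
      using h_less[OF ij] by (simp add: add.commute) (metis cong_add_rcancel_nat cong_sym cong_trans)
    then have "[h j - h i = p ^ n] (mod p ^ Suc n)" by (simp only: cong_add_rcancel_nat)
    then show ?thesis
      unfolding n_def[symmetric] using prime_gt_1_nat[OF p'(1)]
      by (intro multiplicity_cong_nat[of _ "p ^ n"]) (auto dest: power_dvd_imp_le)
  qed
  show thesis
  proof (rule that[of h "\<lambda>i j s. qq (i, j, s)"])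
    show "h i < h j" if "i < j" "j < k" for i j using h_less that .
    show "[h l = p ^ l] (mod p ^ k)" if "prime p" "p \<le> k" "l < k" for p l
      using hF[of l p] F(3) that by (simp add: c_def f_def)
    show "i = i' \<and> j = j'" if p: "prime p" "k < p" and ij: "i < j" "j < k" "i' < j'" "j' < k"
      "p dvd h j - h i" "p dvd h j' - h i'" for p i j i' j'
    proof (cases "p \<in> P")
      case True
      obtain i0 j0 s where "ix p = (i0, j0, s)" by (cases "ix p") auto
      then show ?thesis using pair_of_gadget[OF True] ij by metis
    next
      case False
      then have "p \<notin> F" using p by (auto simp: F_def P0_def)
      then show ?thesis using h_gen[OF p(1)] ij by blast
    qed
    show "prime (qq (i, j, s)) \<and> k < qq (i, j, s) \<and> multiplicity (qq (i, j, s)) (h j - h i) = M i j s - 1"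
      if "i < j" "j < k" for i j s
    proof -
      have z: "(i, j, s) \<in> I" using that by (simp add: I_def)
      then have "qq (i, j, s) \<in> P" using qq by (auto simp: bij_betw_def)
      then show ?thesis using gadget[of "qq (i, j, s)" i j s] ixq[OF z] P(3,4) by (auto simp: not_le[symmetric])
    qed
    show "qq (i, j, True) \<noteq> qq (i, j, False)" if "i < j" "j < k" for i j
      using ixq[of "(i, j, True)"] ixq[of "(i, j, False)"] that by (auto simp: I_def)
    show "h l \<le> 2 ^ \<Lambda>" if "l < k" for l
      using h that Q_le by (meson order_trans)
  qed
qed

section \<open>Prescribing exponents at a single prime\<close>

text \<open>If both surpluses vanish, \<open>N + c\<close> is made congruent to \<open>D\<close>;
  then \<open>N + c + D\<close> is congruent to \<open>2 * D\<close>, and \<open>p > 2\<close> keeps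
  the exponent \<open>v\<close>. A positive surplus makes one of the two numbers divisible by
  \<open>p ^ Suc v\<close>, and the other inherits the exponent \<open>v\<close> of
  \<open>D\<close>.\<close>

lemma local_pair_residue:
  fixes p D c v x z :: nat
  assumes p: "prime p" "p > 2" and D: "D > 0" "multiplicity p D = v" and xz: "x = 0 \<or> z = 0"
  shows "\<exists>r. \<forall>N. [N = r] (mod p ^ (v + x + z + 1)) \<longrightarrow>
    multiplicity p (N + c) = v + x \<and> multiplicity p (N + c + D) = v + z"
proof -
  have p1: "p > 1" and np: "\<not> is_unit p" using p by auto
  have dD: "p ^ v dvd D" "\<not> p ^ Suc v dvd D"
    using D p1 np multiplicity_dvd[of p D] power_dvd_iff_le_multiplicity[of D p "Suc v"] by auto
  have ndvd: "\<not> p ^ Suc n dvd p ^ n" for n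
    using p1 by (auto dest: power_dvd_imp_le)
  consider "x = 0" "z = 0" | "x > 0" "z = 0" | "x = 0" "z > 0" using xz by blast
  then show ?thesis
  proof cases
    case 1
    obtain r where r: "[r + c = D] (mod p ^ Suc v)"
      using ex_shift_cong_nat[of "p ^ Suc v" c D] p1 by auto
    have "multiplicity p (N + c) = v \<and> multiplicity p (N + c + D) = v" if N: "[N = r] (mod p ^ Suc v)" for N
    proof -
      have a: "[N + c = D] (mod p ^ Suc v)" using N r by (meson cong_add cong_refl cong_trans)
      then have b: "[N + c + D = 2 * D] (mod p ^ Suc v)"
        using cong_add[OF a cong_refl[of D]] by (simp add: mult_2)
      have "coprime (p ^ Suc v) 2"
        using p primes_coprime[of p 2] by (simp add: two_is_prime_nat)
      then have "\<not> p ^ Suc v dvd 2 * D" using dD by (simp add: coprime_dvd_mult_right_iff)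
      then show ?thesis
        using multiplicity_cong_nat[OF a dD] multiplicity_cong_nat[OF b] dD by simp
    qed
    then show ?thesis using 1 by auto
  next
    case 2
    obtain r where r: "[r + c = p ^ (v + x)] (mod p ^ Suc (v + x))"
      using ex_shift_cong_nat[of "p ^ Suc (v + x)" c "p ^ (v + x)"] p1 by auto
    have "multiplicity p (N + c) = v + x \<and> multiplicity p (N + c + D) = v"
      if N: "[N = r] (mod p ^ Suc (v + x))" for N
    proof -
      have a: "[N + c = p ^ (v + x)] (mod p ^ Suc (v + x))" using N r by (meson cong_add cong_refl cong_trans)
      have d: "p ^ Suc v dvd N + c"
        using cong_power_dvd_iff_nat[OF a, of "Suc v"] 2 by (simp add: le_imp_power_dvd del: power_Suc)
      have "multiplicity p (N + c + D) = v"
      proof (rule multiplicity_eqI)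
        show "p ^ v dvd N + c + D" using d dD by (meson dvd_add dvd_trans le_imp_power_dvd le_SucI order_refl)
        show "\<not> p ^ Suc v dvd N + c + D" using d dD by (meson dvd_add_right_iff)
      qed
      then show ?thesis using multiplicity_cong_nat[OF a _ ndvd] by simp
    qed
    then show ?thesis using 2 by auto
  next
    case 3
    obtain r where r: "[r + (c + D) = p ^ (v + z)] (mod p ^ Suc (v + z))"
      using ex_shift_cong_nat[of "p ^ Suc (v + z)" "c + D" "p ^ (v + z)"] p1 by auto
    have "multiplicity p (N + c) = v \<and> multiplicity p (N + c + D) = v + z"
      if N: "[N = r] (mod p ^ Suc (v + z))" for N
    proof -
      have a: "[N + c + D = p ^ (v + z)] (mod p ^ Suc (v + z))"
        unfolding add.assoc using N r by (meson cong_add cong_refl cong_trans)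
      have d: "p ^ Suc v dvd N + c + D"
        using cong_power_dvd_iff_nat[OF a, of "Suc v"] 3 by (simp add: le_imp_power_dvd del: power_Suc)
      have "multiplicity p (N + c) = v"
      proof (rule multiplicity_eqI)
        have "p ^ v dvd N + c + D" using d by (meson dvd_trans le_imp_power_dvd le_SucI order_refl)
        then show "p ^ v dvd N + c" using dD(1) by (meson dvd_add_left_iff)
        show "\<not> p ^ Suc v dvd N + c" using d dD(2) by (meson dvd_add_right_iff)
      qed
      then show ?thesis using multiplicity_cong_nat[OF a _ ndvd] by simp
    qed
    then show ?thesis using 3 by auto
  qed
qed

lemma local_private_residue:
  fixes p c v :: nat
  assumes "prime p"
  shows "\<exists>r. \<forall>N. [N = r] (mod p ^ Suc v) \<longrightarrow> multiplicity p (N + c) = v"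
proof -
  have p1: "p > 1" using prime_gt_1_nat assms by blast
  obtain r where r: "[r + c = p ^ v] (mod p ^ Suc v)"
    using ex_shift_cong_nat[of "p ^ Suc v" c "p ^ v"] p1 by auto
  have "multiplicity p (N + c) = v" if "[N = r] (mod p ^ Suc v)" for N
  proof (rule multiplicity_cong_nat)
    show "[N + c = p ^ v] (mod p ^ Suc v)" using that r by (meson cong_add cong_refl cong_trans)
  qed (use p1 in \<open>auto dest: power_dvd_imp_le\<close>)
  then show ?thesis by blast
qed

section \<open>All positive rationals are attained\<close>

lemma prod_prime_powers_dvd:
  fixes n :: nat
  assumes "finite S" "\<And>p. p \<in> S \<Longrightarrow> prime p" "\<And>p. p \<in> S \<Longrightarrow> p ^ f p dvd n"
  shows "(\<Prod>p\<in>S. p ^ f p) dvd n"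
  using assms
proof (induction S rule: finite_induct)
  case (insert p S)
  have "coprime (p ^ f p) (\<Prod>q\<in>S. q ^ f q)"
  proof (rule prod_coprime_right)
    fix q assume "q \<in> S"
    then have "coprime p q" using insert by (intro primes_coprime) auto
    then show "coprime (p ^ f p) (q ^ f q)" by simp
  qed
  then show ?case using insert by (auto intro: divides_mult)
qed simp

lemma eq_prod_prime_powers:
  fixes n :: nat
  assumes "finite S" "\<And>p. p \<in> S \<Longrightarrow> prime p" "\<And>p. prime p \<Longrightarrow> p dvd n \<Longrightarrow> p \<in> S" "n > 0"
  shows "n = (\<Prod>p\<in>S. p ^ multiplicity p n)"
proof -
  have "n = (\<Prod>p\<in>prime_factors n. p ^ multiplicity p n)"
    using assms(4) by (rule prime_factorization_nat)
  also have "\<dots> = (\<Prod>p\<in>S. p ^ multiplicity p n)"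
    using assms by (intro prod.mono_neutral_left) (auto simp: prime_factors_dvd not_dvd_imp_multiplicity_0)
  finally show ?thesis .
qed

text \<open>Dividing the equation by the common factor leaves \<open>x * L + 1 = x' * L'\<close>. By
  coprimality both divisor counts factor, and the equal counts of \<open>L\<close> and
  \<open>L'\<close> drop out of the ratio.\<close>

lemma consecutive_of_equal_divisor_counts:
  fixes S :: "nat set" and e\<^sub>i e\<^sub>j :: "nat \<Rightarrow> nat"
  assumes S: "finite S" "\<And>p. p \<in> S \<Longrightarrow> prime p"
    and cop: "\<And>p. p \<in> S \<Longrightarrow> coprime p L" "\<And>p. p \<in> S \<Longrightarrow> coprime p L'"
    and eq: "(\<Prod>p\<in>S. p ^ e\<^sub>i p) * L + (\<Prod>p\<in>S. p ^ min (e\<^sub>i p) (e\<^sub>j p)) = (\<Prod>p\<in>S. p ^ e\<^sub>j p) * L'"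
    and ratio: "(\<Prod>p\<in>S. e\<^sub>j p - e\<^sub>i p + 1) * b = a * (\<Prod>p\<in>S. e\<^sub>i p - e\<^sub>j p + 1)"
    and d: "divisor_count L = divisor_count L'"
  shows "\<exists>m\<ge>L. divisor_count (m + 1) * b = a * divisor_count m"
proof -
  define g where "g = (\<Prod>p\<in>S. p ^ min (e\<^sub>i p) (e\<^sub>j p))"
  \<comment> \<open>Truncated subtraction yields what remains of each exponent once the minimum is
    removed.\<close>
  define x where "x = (\<Prod>p\<in>S. p ^ (e\<^sub>i p - e\<^sub>j p))"
  define x' where "x' = (\<Prod>p\<in>S. p ^ (e\<^sub>j p - e\<^sub>i p))"
  have "g > 0" "x > 0" unfolding g_def x_def using S(2) by (auto intro!: prod_pos simp: prime_gt_0_nat)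
  have gx: "(\<Prod>p\<in>S. p ^ e\<^sub>i p) = g * x" "(\<Prod>p\<in>S. p ^ e\<^sub>j p) = g * x'"
    unfolding g_def x_def x'_def prod.distrib[symmetric] power_add[symmetric]
    by (auto intro!: prod.cong arg_cong2[where f = "(^)"])
  have "g * (x * L + 1) = g * (x' * L')"
    using eq unfolding gx g_def[symmetric] by (simp add: algebra_simps)
  then have succ: "x * L + 1 = x' * L'" using \<open>g > 0\<close> by (simp only: nat_mult_eq_cancel1)
  have c: "coprime x L" "coprime x' L'"
    unfolding x_def x'_def using cop by (auto intro!: prod_coprime_left)
  have dx: "divisor_count x = (\<Prod>p\<in>S. e\<^sub>i p - e\<^sub>j p + 1)"
    "divisor_count x' = (\<Prod>p\<in>S. e\<^sub>j p - e\<^sub>i p + 1)"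
    unfolding x_def x'_def by (simp_all only: divisor_count_prod_prime_powers[OF S])
  have "divisor_count (x * L) = (\<Prod>p\<in>S. e\<^sub>i p - e\<^sub>j p + 1) * divisor_count L"
    by (simp only: divisor_count_mult[OF c(1)] dx)
  moreover have "divisor_count (x * L + 1) = (\<Prod>p\<in>S. e\<^sub>j p - e\<^sub>i p + 1) * divisor_count L"
    by (simp only: succ d divisor_count_mult[OF c(2)] dx)
  ultimately have "divisor_count (x * L + 1) * b = a * divisor_count (x * L)"
    using arg_cong[OF ratio, of "\<lambda>z. z * divisor_count L"] by (simp only: mult_ac)
  moreover have "L \<le> x * L" using \<open>x > 0\<close> by simp
  ultimately show ?thesis by blast
qed

text \<open>\<open>N + h l + W * n\<close> splits into \<open>w l\<close>, composed of primes of
  \<open>S\<close>, and a form \<open>B l + A l * n\<close> coprime to \<open>W\<close>. Two of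
  these forms have equal divisor counts, and \<open>h j - h i\<close> is exactly the common part of
  \<open>w i\<close> and \<open>w j\<close>.\<close>

lemma consecutive_of_design:
  fixes h :: "nat \<Rightarrow> nat" and e :: "nat \<Rightarrow> nat \<Rightarrow> nat" and s :: "nat \<Rightarrow> nat" and t N a b :: nat
  defines "y \<equiv> 2 ^ (2 ^ (t\<^sup>2))"
  assumes t: "t \<ge> 3"
    and S: "finite S" "\<And>p. p \<in> S \<Longrightarrow> prime p" "\<And>p. prime p \<Longrightarrow> p \<le> 20 * t \<Longrightarrow> p \<in> S"
    and N: "N > 0"
    and e: "\<And>p l. p \<in> S \<Longrightarrow> l < 20 * t \<Longrightarrow> multiplicity p (N + h l) = e p l"
    and s: "\<And>p l. p \<in> S \<Longrightarrow> l < 20 * t \<Longrightarrow> e p l < s p"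
    and h_less: "\<And>i j. i < j \<Longrightarrow> j < 20 * t \<Longrightarrow> h i < h j"
    and h_dvd: "\<And>p i j. prime p \<Longrightarrow> i < j \<Longrightarrow> j < 20 * t \<Longrightarrow> p dvd h j - h i \<Longrightarrow> p \<in> S"
    and h_mult: "\<And>p i j. p \<in> S \<Longrightarrow> i < j \<Longrightarrow> j < 20 * t \<Longrightarrow>
      multiplicity p (h j - h i) = min (e p i) (e p j)"
    and ratio: "\<And>i j. i < j \<Longrightarrow> j < 20 * t \<Longrightarrow>
      (\<Prod>p\<in>S. e p j - e p i + 1) * b = a * (\<Prod>p\<in>S. e p i - e p j + 1)"
    and W_le: "(\<Prod>p\<in>S. p ^ s p) \<le> y" and N_le: "\<And>l. l < 20 * t \<Longrightarrow> N + h l \<le> y\<^sup>2"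
  shows "\<exists>m\<ge>y. divisor_count (m + 1) * b = a * divisor_count m"
proof -
  define W where "W = (\<Prod>p\<in>S. p ^ s p)"
  define w where "w = (\<lambda>l. \<Prod>p\<in>S. p ^ e p l)"
  define A where "A = (\<lambda>l. \<Prod>p\<in>S. p ^ (s p - e p l))"
  define B where "B = (\<lambda>l. (N + h l) div w l)"
  have W_pos: "W > 0" unfolding W_def using S(2) by (auto intro!: prod_pos simp: prime_gt_0_nat)
  have A_pos: "A l > 0" for l unfolding A_def using S(2) by (auto intro!: prod_pos simp: prime_gt_0_nat)
  have W: "W = w l * A l" if "l < 20 * t" for l
    unfolding W_def w_def A_def prod.distrib[symmetric] power_add[symmetric]
    using s that by (intro prod.cong refl arg_cong2[where f = "(^)"]) (simp add: less_imp_le)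
  have B: "N + h l = w l * B l" if "l < 20 * t" for l
  proof -
    have "w l dvd N + h l"
      unfolding w_def using S by (intro prod_prime_powers_dvd) (auto simp: e[symmetric] that multiplicity_dvd)
    then show ?thesis by (simp add: B_def)
  qed
  have p_dvd_W: "p dvd W" if "p \<in> S" for p
  proof -
    have "s p > 0" using s[OF that, of 0] t by simp
    then have "p dvd p ^ s p" by (simp add: dvd_power)
    also have "p ^ s p dvd W" unfolding W_def using S that by (intro dvd_prodI) auto
    finally show ?thesis .
  qed
  have cop: "coprime p (B l + A l * n)" if p: "p \<in> S" and l: "l < 20 * t" for p l n
  proof -
    have "\<not> p dvd B l"
    proof
      assume "p dvd B l"
      moreover have "p ^ e p l dvd w l" unfolding w_def using S p by (intro dvd_prodI) auto
      ultimately have "p ^ e p l * p dvd N + h l" unfolding B[OF l] by (rule mult_dvd_mono[rotated])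
      then have "p ^ Suc (e p l) dvd N + h l" by (simp add: mult.commute)
      moreover have "\<not> is_unit p" using S(2)[OF p] by auto
      ultimately have "Suc (e p l) \<le> multiplicity p (N + h l)"
        using N by (intro multiplicity_geI) auto
      then show False using e[OF p l] by simp
    qed
    \<comment> \<open>The strict inequality \<open>e p l < s p\<close> makes \<open>A l\<close>
      divisible by \<open>p\<close>, so \<open>B l\<close> alone decides whether \<open>p\<close>
      divides the form.\<close>
    moreover have "p dvd p ^ (s p - e p l)" using s[OF p l] by (simp add: dvd_power)
    then have "p dvd A l" unfolding A_def using S p by (intro dvd_trans[OF _ dvd_prodI]) auto
    ultimately have "\<not> p dvd B l + A l * n" by (simp add: dvd_add_left_iff)
    then show ?thesis using S(2)[OF p] by (intro prime_imp_coprime)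
  qed
  have copW: "coprime (B l + A l * n) W" if "l < 20 * t" for l n
    unfolding W_def using cop[OF _ that] by (auto intro!: prod_coprime_right simp: coprime_commute)
  have "B l \<le> y\<^sup>2" if "l < 20 * t" for l
    using N_le[OF that] div_le_dividend[of "N + h l" "w l"] unfolding B_def by linarith
  then have "\<exists>n\<ge>y. \<exists>i j. i < j \<and> j < 20 * t \<and>
    divisor_count (B i + A i * n) = divisor_count (B j + A j * n)"
    unfolding y_def using t W_pos W_le copW S(3) p_dvd_W W
    by (intro equal_divisor_counts[of t W]) (auto simp: W_def[symmetric] y_def)
  then obtain n i j where n: "n \<ge> y" and ij: "i < j" "j < 20 * t"
    and d: "divisor_count (B i + A i * n) = divisor_count (B j + A j * n)" by blast
  have i: "i < 20 * t" using ij by simp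
  have u: "w l * (B l + A l * n) = N + h l + W * n" if "l < 20 * t" for l
    using B[OF that] W[OF that] by (simp add: distrib_left)
  have "h j - h i = (\<Prod>p\<in>S. p ^ multiplicity p (h j - h i))"
  proof (rule eq_prod_prime_powers[OF S(1,2)])
    show "p \<in> S" if "prime p" "p dvd h j - h i" for p using h_dvd[OF that(1) ij that(2)] .
    show "h j - h i > 0" using h_less[OF ij] by simp
  qed
  also have "\<dots> = (\<Prod>p\<in>S. p ^ min (e p i) (e p j))"
    by (intro prod.cong refl) (simp add: h_mult[OF _ ij])
  finally have g: "(\<Prod>p\<in>S. p ^ min (e p i) (e p j)) = h j - h i" by simp
  have "\<exists>m\<ge>B i + A i * n. divisor_count (m + 1) * b = a * divisor_count m"
  proof (rule consecutive_of_equal_divisor_counts[OF S(1,2) cop[OF _ i] cop[OF _ ij(2)] _ ratio[OF ij] d])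
    show "(\<Prod>p\<in>S. p ^ e p i) * (B i + A i * n) + (\<Prod>p\<in>S. p ^ min (e p i) (e p j)) =
      (\<Prod>p\<in>S. p ^ e p j) * (B j + A j * n)"
      using u[OF i] u[OF ij(2)] h_less[OF ij] unfolding g w_def by simp
  qed
  moreover have "y \<le> B i + A i * n"
    using n A_pos[of i] mult_le_mono1[of 1 "A i" n] by linarith
  ultimately show ?thesis by (meson order_trans)
qed

section \<open>Compensated exponents and size bounds\<close>

text \<open>\<open>u\<close> and \<open>w\<close> are the exponents of a prime at two shifts,
  \<open>E\<close> and \<open>E'\<close> the factors from its compensating primes there. If one
  exponent is 0, the other truncated difference plus one is a full factor \<open>1 + u\<close> or
  \<open>1 + w\<close>, so the prime has no net effect on the ratio.\<close>

lemma compensated_factor_eq: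
  fixes u w E E' :: nat
  assumes "E * (1 + u) = E' * (1 + w)" "u = 0 \<or> w = 0 \<or> u = w"
  shows "(w - u + 1) * E' = (u - w + 1) * E"
proof (cases "u = w")
  case True
  then have "E = E'" using assms(1) by (simp only: mult_cancel2) simp
  then show ?thesis using True by simp
next
  case False
  then show ?thesis using assms by (auto simp: mult.commute)
qed

text \<open>The exponents \<open>2 * c - 1\<close> and \<open>4 * c - 3\<close> give
  \<open>2 * c\<close> and \<open>2 * (2 * c - 1)\<close> divisors. The reduced power has
  \<open>2 * c - 1\<close> divisors, which cancels and leaves the net factor
  \<open>c\<close>.\<close>

lemma compensated_factor_mult:
  fixes c E E' :: nat
  assumes "E * (1 + (2 * c - 1)) = E' * (1 + ((2 * c - 1) + (2 * c - 2)))" "c > 0"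
  shows "((2 * c - 2) + 1) * E' = c * E"
proof -
  obtain d where d: "c = Suc d" using assms(2) by (cases c) auto
  have "2 * (((2 * c - 2) + 1) * E') = E' * (1 + ((2 * c - 1) + (2 * c - 2)))"
    unfolding d by (simp add: algebra_simps)
  also have "\<dots> = E * (1 + (2 * c - 1))" by (rule assms(1)[symmetric])
  also have "\<dots> = 2 * (c * E)" unfolding d by (simp add: algebra_simps)
  finally show ?thesis by simp
qed

lemma card_prime_factors_le_log:
  fixes n :: nat
  assumes "n > 0" "n \<le> 2 ^ l"
  shows "card (prime_factors n) \<le> l"
proof -
  have "2 ^ card (prime_factors n) \<le> \<Prod>(prime_factors n)"
    by (intro power_card_le_prod) (auto intro: prime_ge_2_nat)
  also have "\<dots> \<le> n"
    using assms(1) by (intro dvd_imp_le prod_primes_dvd) auto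
  also note assms(2)
  finally show ?thesis by simp
qed

lemma multiplicity_le_log:
  fixes n p :: nat
  assumes "n > 0" "n \<le> 2 ^ l" "prime p"
  shows "multiplicity p n \<le> l"
proof -
  have "2 ^ multiplicity p n \<le> p ^ multiplicity p n"
    using prime_ge_2_nat[OF assms(3)] by (intro power_mono) auto
  also have "\<dots> \<le> n" using assms(1) by (intro dvd_imp_le multiplicity_dvd)
  also note assms(2)
  finally show ?thesis by simp
qed

text \<open>\<open>C\<close> bounds the number of primes in \<open>W\<close>, \<open>C^2\<close> the
  binary logarithm of their size, and the last factor their exponents. The proof uses that
  \<open>C\<close> is at most \<open>\<Lambda> ^ 5\<close>.\<close>

lemma design_size_bound:
  fixes k \<Lambda> :: nat
  assumes "k \<le> \<Lambda>" "60 \<le> \<Lambda>"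
  defines "C \<equiv> k ^ 3 * \<Lambda> + k\<^sup>2 * \<Lambda> + k + 6"
  shows "C * C\<^sup>2 * (2 * (1 + 2 * \<Lambda>)\<^sup>2) \<le> \<Lambda> ^ 18"
proof -
  have "C \<le> \<Lambda> ^ 3 * \<Lambda> + \<Lambda>\<^sup>2 * \<Lambda> + \<Lambda> + \<Lambda>"
    unfolding C_def using assms by (intro add_mono mult_mono power_mono) auto
  also have "\<dots> \<le> \<Lambda> ^ 4 + \<Lambda> ^ 4 + \<Lambda> ^ 4 + \<Lambda> ^ 4"
    using assms power_increasing[of 3 4 \<Lambda>] power_increasing[of 1 4 \<Lambda>]
    by (intro add_mono) (auto simp: eval_nat_numeral)
  also have "\<dots> = 4 * \<Lambda> ^ 4" by simp
  also have "\<dots> \<le> \<Lambda> * \<Lambda> ^ 4" using assms by (intro mult_right_mono) auto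
  finally have C: "C \<le> \<Lambda> ^ 5" by (simp add: eval_nat_numeral)
  have "2 * (1 + 2 * \<Lambda>)\<^sup>2 \<le> 2 * (3 * \<Lambda>)\<^sup>2"
    using assms by (intro mult_left_mono power_mono) auto
  also have "\<dots> = 18 * \<Lambda>\<^sup>2" by (simp add: power2_eq_square)
  also have "\<dots> \<le> \<Lambda> * \<Lambda>\<^sup>2" using assms by (intro mult_right_mono) auto
  finally have "2 * (1 + 2 * \<Lambda>)\<^sup>2 \<le> \<Lambda> ^ 3" by (simp add: eval_nat_numeral)
  then have "C * C\<^sup>2 * (2 * (1 + 2 * \<Lambda>)\<^sup>2) \<le> \<Lambda> ^ 5 * (\<Lambda> ^ 5)\<^sup>2 * \<Lambda> ^ 3"
    using C by (intro mult_mono power_mono) auto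
  also have "\<dots> = \<Lambda> ^ 18" by (simp flip: power_mult power_add)
  finally show ?thesis .
qed

text \<open>The shifts come from \<open>design_sequence\<close>, and \<open>N\<close> is prescribed
  prime by prime. The ratio has to be \<open>a / b\<close> for every pair at once, because
  \<open>equal_divisor_counts\<close> does not tell which pair it selects. The hypothesis on
  \<open>\<Lambda>\<close> keeps \<open>W\<close> below \<open>2 ^ (2 ^ (t^2))\<close>.\<close>

lemma ratio_attained:
  fixes a b t :: nat
  defines "k \<equiv> 20 * t"
  defines "m \<equiv> 2 * a + 2 * b * k ^ k"
  defines "\<Lambda> \<equiv> (2 + (k + 1 + 2 * k\<^sup>2) * (2 * k\<^sup>2 + k + 6)\<^sup>2 * (k + m)) * (k\<^sup>2 + 1) ^ k"
  assumes ab: "a > 0" "b > 0" and t: "t \<ge> 3" and \<Lambda>: "\<Lambda> ^ 18 \<le> 2 ^ (t\<^sup>2)"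
  shows "\<exists>n\<ge>2 ^ (2 ^ (t\<^sup>2)). divisor_count (n + 1) * b = a * divisor_count n"
proof -
  have k: "k \<ge> 60" using t by (simp add: k_def)
  define P0 where "P0 = {p. prime p \<and> p \<le> k}"
  have finP0: "finite P0" by (rule finite_subset[of _ "{..k}"]) (auto simp: P0_def)
  define c where "c = (\<lambda>i j. (j - i + 1) ^ card P0 :: nat)"
  have c_pos: "c i j > 0" for i j by (simp add: c_def)
  \<comment> \<open>Every prime up to \<open>k\<close> contributes \<open>j - i + 1\<close> to the ratio for \<open>(i, j)\<close>, altogether \<open>c i j\<close>.
    The two primes \<open>q i j s\<close> below divide the difference for \<open>(i, j)\<close> only. Such a prime with exponents
    \<open>M - 1\<close> and \<open>2 M - 3\<close> in \<open>u\<^sub>i\<close> and \<open>u\<^sub>j\<close> (in this or the other order) contributes \<open>M/2\<close> or \<open>2/M\<close> to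
    the ratio for \<open>(i, j)\<close>, apart from a factor of the form \<open>\<phi>\<^sub>j/\<phi>\<^sub>i\<close> that it contributes to all pairs.\<close>
  define M where "M = (\<lambda>i j s. if s then 2 * a else 2 * (b * c i j))"
  have cardP0: "card P0 \<le> k"
  proof -
    have "P0 \<subseteq> {1..k}" by (auto simp: P0_def prime_gt_0_nat Suc_le_eq)
    then have "card P0 \<le> card {1..k}" by (intro card_mono) auto
    then show ?thesis by simp
  qed
  have M2: "2 \<le> M i j s" for i j s using ab c_pos[of i j] by (cases s) (auto simp: M_def Suc_le_eq)
  have Mm: "M i j s \<le> m" if "i < j" "j < k" for i j s
  proof -
    have "c i j \<le> k ^ card P0" unfolding c_def using that by (intro power_mono) auto
    also have "\<dots> \<le> k ^ k" using cardP0 k by (intro power_increasing) auto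
    finally have "2 * (b * c i j) \<le> 2 * (b * k ^ k)" by (intro mult_le_mono2)
    then show ?thesis
      unfolding M_def m_def mult.assoc by (cases s; simp only: if_True if_False; linarith)
  qed
  obtain h q where h_less: "\<And>i j. i < j \<Longrightarrow> j < k \<Longrightarrow> h i < h j"
    and h_small: "\<And>p l. prime p \<Longrightarrow> p \<le> k \<Longrightarrow> l < k \<Longrightarrow> [h l = p ^ l] (mod p ^ k)"
    and h_unique: "\<And>p i j i' j'. prime p \<Longrightarrow> k < p \<Longrightarrow> i < j \<Longrightarrow> j < k \<Longrightarrow> i' < j' \<Longrightarrow> j' < k \<Longrightarrow>
      p dvd h j - h i \<Longrightarrow> p dvd h j' - h i' \<Longrightarrow> i = i' \<and> j = j'"
    and q: "\<And>i j s. i < j \<Longrightarrow> j < k \<Longrightarrow> prime (q i j s) \<and> k < q i j s \<and>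
      multiplicity (q i j s) (h j - h i) = M i j s - 1"
    and q_neq: "\<And>i j. i < j \<Longrightarrow> j < k \<Longrightarrow> q i j True \<noteq> q i j False"
    and h_le: "\<And>l. l < k \<Longrightarrow> h l \<le> 2 ^ \<Lambda>"
  proof (rule design_sequence[of k M m, folded \<Lambda>_def])
    show "k > 0" using k by simp
    show "2 \<le> M i j s" for i j s by (rule M2)
    show "M i j s \<le> m" if "i < j" "j < k" for i j s using that by (rule Mm)
  qed (rule that; assumption)
  have diff: "0 < h j - h i" "h j - h i \<le> 2 ^ \<Lambda>" if "i < j" "j < k" for i j
    using h_less[OF that] h_le[OF that(2)] by auto
  define T where "T = {p. prime p \<and> k < p \<and> (\<exists>i j. i < j \<and> j < k \<and> p dvd h j - h i)}"
  have "\<forall>p\<in>T. \<exists>i j. i < j \<and> j < k \<and> p dvd h j - h i" by (auto simp: T_def)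
  then obtain \<alpha> \<beta> where \<alpha>\<beta>: "\<And>p. p \<in> T \<Longrightarrow> \<alpha> p < \<beta> p" "\<And>p. p \<in> T \<Longrightarrow> \<beta> p < k"
    "\<And>p. p \<in> T \<Longrightarrow> p dvd h (\<beta> p) - h (\<alpha> p)" by metis
  have T_prime: "prime p" "k < p" if "p \<in> T" for p using that by (auto simp: T_def)
  have T_unique: "i = \<alpha> p \<and> j = \<beta> p" if "p \<in> T" "i < j" "j < k" "p dvd h j - h i" for p i j
    using h_unique[OF T_prime[OF that(1)] that(2,3) \<alpha>\<beta>(1,2)[OF that(1)] that(4) \<alpha>\<beta>(3)[OF that(1)]] .
  define v where "v = (\<lambda>p. multiplicity p (h (\<beta> p) - h (\<alpha> p)))"
  \<comment> \<open>The surpluses beyond \<open>v = M - 1\<close> at the special primes. The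
    \<open>True\<close> prime carries it on the later shift and multiplies the ratio by
    \<open>a\<close>; the \<open>False\<close> prime carries it on the earlier one and divides by
    \<open>b * c i j\<close>, which also removes the contribution of the small primes.\<close>
  define x where "x = (\<lambda>p. if p = q (\<alpha> p) (\<beta> p) False then M (\<alpha> p) (\<beta> p) False - 2 else 0)"
  define z where "z = (\<lambda>p. if p = q (\<alpha> p) (\<beta> p) True then M (\<alpha> p) (\<beta> p) True - 2 else 0)"
  have xz: "x p = 0 \<or> z p = 0" if "p \<in> T" for p
    using q_neq[OF \<alpha>\<beta>(1,2)[OF that]] by (auto simp: x_def z_def)
  have v_pos: "v p > 0" if "p \<in> T" for p
    unfolding v_def using \<alpha>\<beta>[OF that] T_prime[OF that] diff[OF \<alpha>\<beta>(1,2)[OF that]]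
    by (intro multiplicity_gt_zero_iff[THEN iffD2]) auto
  have v_le: "v p \<le> \<Lambda>" if "p \<in> T" for p
    unfolding v_def using diff[OF \<alpha>\<beta>(1,2)[OF that]] T_prime[OF that] by (intro multiplicity_le_log) auto
  have xz_le: "x p \<le> v p" "z p \<le> v p" if "p \<in> T" for p
  proof -
    note ij = \<alpha>\<beta>(1,2)[OF that]
    show "x p \<le> v p" using q[OF ij, of False] by (auto simp: x_def v_def)
    show "z p \<le> v p" using q[OF ij, of True] by (auto simp: z_def v_def)
  qed
  define e0 where "e0 = (\<lambda>p l. if l = \<alpha> p then v p + x p else if l = \<beta> p then v p + z p else 0)"
  \<comment> \<open>The factors \<open>\<phi>\<^sub>j/\<phi>\<^sub>i\<close> are cancelled by further primes, one for each \<open>p \<in> T\<close> and \<open>l\<close>, which divide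
    \<open>u\<^sub>l\<close> exactly \<open>EE p l - 1\<close> times and no other \<open>u\<^sub>i\<close>: the product \<open>EE p l * (1 + e0 p l)\<close> does not
    depend on \<open>l\<close>.\<close>
  define EE where "EE = (\<lambda>p l. 2 * (if l = \<alpha> p then 1 + (v p + z p) else if l = \<beta> p then 1 + (v p + x p)
    else (1 + (v p + x p)) * (1 + (v p + z p))))"
  define K where "K = (\<lambda>p. 2 * ((1 + (v p + x p)) * (1 + (v p + z p))))"
  have EEK: "EE p l * (1 + e0 p l) = K p" for p l
    by (simp add: EE_def e0_def K_def algebra_simps)
  \<comment> \<open>The factor 2 in \<open>EE\<close> makes the exponent \<open>EE p l - 1\<close>
    positive, so a compensating prime really divides its own term and hence, by
    \<open>common\<close>, no other.\<close>
  have EE2: "EE p l \<ge> 2" for p l by (simp add: EE_def)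
  have EE_le: "EE p l \<le> 2 * (1 + 2 * \<Lambda>)\<^sup>2" if "p \<in> T" for p l
  proof -
    have b: "1 + (v p + x p) \<le> 1 + 2 * \<Lambda>" "1 + (v p + z p) \<le> 1 + 2 * \<Lambda>"
      using v_le[OF that] xz_le[OF that] by auto
    have "1 + 2 * \<Lambda> \<le> (1 + 2 * \<Lambda>)\<^sup>2" by (rule self_le_power) auto
    moreover have "(1 + (v p + x p)) * (1 + (v p + z p)) \<le> (1 + 2 * \<Lambda>)\<^sup>2"
      unfolding power2_eq_square using b by (rule mult_le_mono)
    ultimately show ?thesis unfolding EE_def using b by auto
  qed

  have common: "p \<in> T \<and> {l, l'} = {\<alpha> p, \<beta> p}"
    if p: "prime p" "k < p" and l: "l < k" "l' < k" "l \<noteq> l'" and d: "p dvd N + h l" "p dvd N + h l'" for p l l' N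
  proof -
    have *: "p \<in> T \<and> i = \<alpha> p \<and> j = \<beta> p" if "i < j" "j < k" "p dvd N + h i" "p dvd N + h j" for i j
    proof -
      have "p dvd (N + h j) - (N + h i)" using that by (intro dvd_diff_nat)
      then have d: "p dvd h j - h i" by simp
      then have "p \<in> T" using p that by (auto simp: T_def)
      then show ?thesis using T_unique[OF _ that(1,2) d] by simp
    qed
    show ?thesis
    proof (cases "l < l'")
      case True
      then show ?thesis using *[of l l'] l d by auto
    next
      case False
      then show ?thesis using *[of l' l] l d by auto
    qed
  qed

  have T_sub: "T \<subseteq> (\<Union>(i, j)\<in>{(i, j). i < j \<and> j < k}. prime_factors (h j - h i))"
  proof
    fix p assume "p \<in> T"
    then obtain i j where "prime p" and ij: "i < j" "j < k" and "p dvd h j - h i"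
      by (auto simp: T_def)
    then have "p \<in> prime_factors (h j - h i)"
      using diff(1)[OF ij] by (simp add: prime_factors_dvd)
    then show "p \<in> (\<Union>(i, j)\<in>{(i, j). i < j \<and> j < k}. prime_factors (h j - h i))"
      using ij by blast
  qed
  have pairs: "{(i, j). i < j \<and> j < k} \<subseteq> {..<k} \<times> {..<k}" by auto
  then have fin_pairs: "finite {(i, j). i < j \<and> j < k}" by (rule finite_subset) auto
  have finT: "finite T" by (rule finite_subset[OF T_sub]) (use fin_pairs in auto)
  have "card T \<le> card (\<Union>(i, j)\<in>{(i, j). i < j \<and> j < k}. prime_factors (h j - h i))"
    using T_sub fin_pairs by (intro card_mono) auto
  also have "\<dots> \<le> (\<Sum>(i, j)\<in>{(i, j). i < j \<and> j < k}. card (prime_factors (h j - h i)))"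
    using card_UN_le[OF fin_pairs, of "\<lambda>(i, j). prime_factors (h j - h i)"] by (simp add: case_prod_unfold)
  also have "\<dots> \<le> (\<Sum>(i, j)\<in>{(i, j). i < j \<and> j < k}. \<Lambda>)"
    using diff by (intro sum_mono) (auto intro!: card_prime_factors_le_log)
  also have "\<dots> \<le> k\<^sup>2 * \<Lambda>"
    using card_mono[OF _ pairs] by (simp add: case_prod_unfold power2_eq_square)
  finally have cardT: "card T \<le> k\<^sup>2 * \<Lambda>" .

  \<comment> \<open>One compensating prime for each element of \<open>T\<close> and each index.
    Lying outside \<open>T\<close> and above \<open>k\<close>, these primes divide no difference of
    shifts.\<close>
  obtain P' where P': "finite P'" "card P' = card (T \<times> {..<k})" "\<And>p. p \<in> P' \<Longrightarrow> prime p"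
    "P' \<inter> (T \<union> {..k}) = {}"
    "\<And>p. p \<in> P' \<Longrightarrow> p \<le> 2 ^ ((card (T \<times> {..<k}) + card (T \<union> {..k}) + 5)\<^sup>2)"
    using obtain_small_primes[of "T \<union> {..k}" "card (T \<times> {..<k})"] finT by auto
  have finTk: "finite (T \<times> {..<k})" using finT by simp
  obtain \<eta> where \<eta>: "bij_betw \<eta> (T \<times> {..<k}) P'"
    using finite_same_card_bij[OF finTk P'(1)] P'(2) by auto
  define ix where "ix = inv_into (T \<times> {..<k}) \<eta>"
  have ixI: "ix p \<in> T \<times> {..<k}" "\<eta> (ix p) = p" if "p \<in> P'" for p
    using that \<eta> unfolding ix_def by (metis bij_betw_imp_surj_on inv_into_into, metis bij_betw_inv_into_right)
  have ix\<eta>: "ix (\<eta> w) = w" if "w \<in> T \<times> {..<k}" for w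
    using that \<eta> unfolding ix_def by (metis bij_betw_inv_into_left)
  have P'_not: "p \<notin> T" "k < p" if "p \<in> P'" for p
    using P'(4) that by (auto simp: not_le[symmetric])

  define S where "S = P0 \<union> (T \<union> P')"
  define e where "e = (\<lambda>p l. if p \<le> k then l else if p \<in> T then e0 p l else
    case ix p of (p0, l0) \<Rightarrow> if l = l0 then EE p0 l0 - 1 else 0)"
  define s where "s = (\<lambda>p. if p \<le> k then k else if p \<in> T then v p + x p + z p + 1 else
    case ix p of (p0, l0) \<Rightarrow> EE p0 l0)"
  have S: "finite S" "\<And>p. p \<in> S \<Longrightarrow> prime p" "\<And>p. prime p \<Longrightarrow> p \<le> k \<Longrightarrow> p \<in> S"
    using finP0 finT P' T_prime by (auto simp: S_def P0_def)
  have e_T: "e p l = e0 p l" if "p \<in> T" for p l using that T_prime(2)[OF that] by (simp add: e_def)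
  have e_\<eta>: "e (\<eta> (p, l0)) l = (if l = l0 then EE p l0 - 1 else 0)" if "p \<in> T" "l0 < k" for p l0 l
  proof -
    have "\<eta> (p, l0) \<in> P'" using that \<eta> by (auto simp: bij_betw_def)
    then show ?thesis using P'_not[of "\<eta> (p, l0)"] ix\<eta>[of "(p, l0)"] that by (simp add: e_def)
  qed
  have e_s: "e p l < s p" if "p \<in> S" "l < k" for p l
  proof (cases "ix p")
    case (Pair p0 l0)
    then show ?thesis using that EE2[of p0 l0] by (auto simp: e_def s_def e0_def)
  qed

  have local: "\<exists>r. \<forall>N. [N = r] (mod p ^ s p) \<longrightarrow> (\<forall>l<k. multiplicity p (N + h l) = e p l)" if p: "p \<in> S" for p
  proof -
    consider "p \<in> P0" | "p \<in> T" | "p \<in> P'" using p by (auto simp: S_def)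
    then show ?thesis
    proof cases
      case 1
      then have pk: "prime p" "p \<le> k" by (auto simp: P0_def)
      \<comment> \<open>Taking \<open>N\<close> divisible by \<open>p ^ k\<close> leaves the
        residues \<open>p ^ l\<close> of the shifts intact.\<close>
      have "multiplicity p (N + h l) = e p l" if N: "[N = 0] (mod p ^ s p)" and l: "l < k" for N l
      proof -
        have "[N + h l = 0 + p ^ l] (mod p ^ k)"
          using N pk h_small[OF pk l] by (intro cong_add) (auto simp: s_def)
        then have "[N + h l = 0 + p ^ l] (mod p ^ Suc l)"
          by (rule cong_dvd_mono_modulus) (use l in \<open>intro le_imp_power_dvd, simp\<close>)
        then have "multiplicity p (N + h l) = l"
          using prime_gt_1_nat[OF pk(1)] by (intro multiplicity_cong_nat[of _ "p ^ l"]) (auto dest: power_dvd_imp_le)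
        then show ?thesis using pk by (simp add: e_def)
      qed
      then show ?thesis by blast
    next
      case 2
      note pT = T_prime[OF 2] and ij = \<alpha>\<beta>(1,2)[OF 2]
      have s: "s p = v p + x p + z p + 1" using 2 pT by (simp add: s_def)
      have "p > 2" using pT k by simp
      then obtain r where r: "\<And>N. [N = r] (mod p ^ s p) \<Longrightarrow> multiplicity p (N + h (\<alpha> p)) = v p + x p \<and>
          multiplicity p (N + h (\<alpha> p) + (h (\<beta> p) - h (\<alpha> p))) = v p + z p"
        using local_pair_residue[OF pT(1) _ diff(1)[OF ij] _ xz[OF 2], of "v p" "h (\<alpha> p)"] unfolding s v_def
        by blast
      have "multiplicity p (N + h l) = e p l" if N: "[N = r] (mod p ^ s p)" and l: "l < k" for N l
      proof -
        have m: "multiplicity p (N + h (\<alpha> p)) = v p + x p" "multiplicity p (N + h (\<beta> p)) = v p + z p"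
          using r[OF N] h_less[OF ij] by (simp_all add: add.assoc)
        show ?thesis
        proof (cases "l = \<alpha> p \<or> l = \<beta> p")
          case True
          then show ?thesis using m ij by (auto simp: e_T[OF 2] e0_def)
        next
          case False
          have "p dvd N + h (\<alpha> p)"
            using m(1) v_pos[OF 2] not_dvd_imp_multiplicity_0[of p "N + h (\<alpha> p)"] by fastforce
          then have "\<not> p dvd N + h l"
            using common[OF pT, of l "\<alpha> p" N] False l ij by auto
          then show ?thesis using False by (simp add: e_T[OF 2] e0_def not_dvd_imp_multiplicity_0)
        qed
      qed
      then show ?thesis by blast
    next
      case 3
      obtain p0 l0 where ix: "ix p = (p0, l0)" by (cases "ix p") auto
      have pl: "p0 \<in> T" "l0 < k" using ixI(1)[OF 3] ix by auto
      define E where "E = EE p0 l0 - 1"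
      have E: "E > 0" "s p = Suc E" using EE2[of p0 l0] P'_not[OF 3] ix by (auto simp: E_def s_def)
      obtain r where r: "\<And>N. [N = r] (mod p ^ s p) \<Longrightarrow> multiplicity p (N + h l0) = E"
        using local_private_residue[OF P'(3)[OF 3], of E "h l0"] unfolding E(2) by blast
      have "multiplicity p (N + h l) = e p l" if N: "[N = r] (mod p ^ s p)" and l: "l < k" for N l
      proof (cases "l = l0")
        case True
        then show ?thesis using r[OF N] P'_not[OF 3] ix by (simp add: e_def E_def)
      next
        case False
        have "p dvd N + h l0"
          using r[OF N] E(1) not_dvd_imp_multiplicity_0[of p "N + h l0"] by fastforce
        then have "\<not> p dvd N + h l"
          using common[OF P'(3)[OF 3] P'_not(2)[OF 3], of l l0 N] False l pl P'_not(1)[OF 3] by auto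
        then show ?thesis using False P'_not[OF 3] ix by (simp add: e_def not_dvd_imp_multiplicity_0)
      qed
      then show ?thesis by blast
    qed
  qed
  then obtain r where r: "\<And>p N l. p \<in> S \<Longrightarrow> [N = r p] (mod p ^ s p) \<Longrightarrow> l < k \<Longrightarrow> multiplicity p (N + h l) = e p l"
    by metis
  define W where "W = (\<Prod>p\<in>S. p ^ s p)"
  have "\<exists>!x. x < (\<Prod>p\<in>S. p ^ s p) \<and> (\<forall>p\<in>S. [x = r p] (mod p ^ s p))"
  proof (rule chinese_remainder_unique_nat)
    show "\<forall>p\<in>S. p ^ s p \<noteq> 0" using S(2) by (auto simp: prime_gt_0_nat)
    show "\<forall>p\<in>S. \<forall>q\<in>S. p \<noteq> q \<longrightarrow> coprime (p ^ s p) (q ^ s q)"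
    proof (intro ballI impI)
      fix p q assume "p \<in> S" "q \<in> S" "p \<noteq> q"
      then have "coprime p q" using S(2) by (intro primes_coprime)
      then show "coprime (p ^ s p) (q ^ s q)" by simp
    qed
  qed (use S in auto)
  then obtain N0 where N0: "N0 < W" "\<And>p. p \<in> S \<Longrightarrow> [N0 = r p] (mod p ^ s p)"
    unfolding W_def by blast
  \<comment> \<open>Adding \<open>W\<close> keeps all residues and makes \<open>N\<close> positive
    even when \<open>N0 = 0\<close>.\<close>
  define N where "N = N0 + W"
  have N_cong: "[N = r p] (mod p ^ s p)" if "p \<in> S" for p
  proof -
    have "p ^ s p dvd W" unfolding W_def using that S by (intro dvd_prodI) auto
    then have "[N = N0 + 0] (mod p ^ s p)" unfolding N_def by (intro cong_add) (auto simp: cong_0_iff)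
    then show ?thesis using N0(2)[OF that] by (metis add_0_right cong_trans)
  qed
  have N_pos: "N > 0" using N0 by (simp add: N_def)

  have "0 < (k + 1 + 2 * k\<^sup>2) * (2 * k\<^sup>2 + k + 6)\<^sup>2"
    by (intro mult_pos_pos zero_less_power) auto
  then have "1 * (k + m) \<le> (k + 1 + 2 * k\<^sup>2) * (2 * k\<^sup>2 + k + 6)\<^sup>2 * (k + m)"
    by (intro mult_le_mono1) linarith
  moreover have "k \<le> (2 + Y) * 1" if "1 * (k + m) \<le> Y" for Y using that by simp
  ultimately have "k \<le> (2 + (k + 1 + 2 * k\<^sup>2) * (2 * k\<^sup>2 + k + 6)\<^sup>2 * (k + m)) * 1" by blast
  also have "\<dots> \<le> \<Lambda>" unfolding \<Lambda>_def by (intro mult_left_mono) auto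
  finally have k\<Lambda>: "k \<le> \<Lambda>" .
  \<comment> \<open>The 6 is the 5 from \<open>obtain_small_primes\<close> plus 1 for the element 0
    of \<open>{..k}\<close>.\<close>
  define C where "C = k ^ 3 * \<Lambda> + k\<^sup>2 * \<Lambda> + k + 6"
  have cardTk: "card (T \<times> {..<k}) \<le> k ^ 3 * \<Lambda>"
    using mult_le_mono1[OF cardT, of k] by (simp add: card_cartesian_product power3_eq_cube power2_eq_square mult_ac)
  have "W \<le> 2 ^ (C * C\<^sup>2 * (2 * (1 + 2 * \<Lambda>)\<^sup>2))"
    unfolding W_def
  proof (rule prod_power_le_power2[OF S(1)])
    have C2: "C \<le> C\<^sup>2" by (rule self_le_power) (auto simp: C_def)
    show "p \<le> 2 ^ C\<^sup>2" if p: "p \<in> S" for p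
    proof -
      consider "p \<in> P0" | "p \<in> T" | "p \<in> P'" using p by (auto simp: S_def)
      then show ?thesis
      proof cases
        case 1
        then have "p \<le> C\<^sup>2" using C2 by (auto simp: P0_def C_def)
        also have "\<dots> \<le> 2 ^ C\<^sup>2" by (simp add: less_imp_le)
        finally show ?thesis .
      next
        case 2
        have "p \<le> h (\<beta> p) - h (\<alpha> p)" using \<alpha>\<beta>[OF 2] diff[OF \<alpha>\<beta>(1,2)[OF 2]] by (intro dvd_imp_le) auto
        also have "\<dots> \<le> 2 ^ \<Lambda>" using diff[OF \<alpha>\<beta>(1,2)[OF 2]] by simp
        also have "(2::nat) ^ \<Lambda> \<le> 2 ^ C\<^sup>2"
        proof (rule power_increasing)
          have "\<Lambda> \<le> k ^ 3 * \<Lambda>" using k by simp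
          also have "\<dots> \<le> C" by (simp add: C_def)
          also note C2
          finally show "\<Lambda> \<le> C\<^sup>2" .
        qed simp
        finally show ?thesis .
      next
        case 3
        have "card (T \<union> {..k}) \<le> k\<^sup>2 * \<Lambda> + (k + 1)" using card_Un_le[of T "{..k}"] cardT by simp
        then have "card (T \<times> {..<k}) + card (T \<union> {..k}) + 5 \<le> C" using cardTk by (simp add: C_def)
        then have "(card (T \<times> {..<k}) + card (T \<union> {..k}) + 5)\<^sup>2 \<le> C\<^sup>2" by (rule power_mono) simp
        then have "(2::nat) ^ (card (T \<times> {..<k}) + card (T \<union> {..k}) + 5)\<^sup>2 \<le> 2 ^ C\<^sup>2"
          by (intro power_increasing) auto
        then show ?thesis using P'(5)[OF 3] by linarith
      qed
    qed
    have big: "3 * \<Lambda> + 1 \<le> 2 * (1 + 2 * \<Lambda>)\<^sup>2"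
      using self_le_power[of "1 + 2 * \<Lambda>" 2] by linarith
    show "s p \<le> 2 * (1 + 2 * \<Lambda>)\<^sup>2" if p: "p \<in> S" for p
    proof -
      consider "p \<in> P0" | "p \<in> T" | "p \<in> P'" using p by (auto simp: S_def)
      then show ?thesis
      proof cases
        case 1
        then show ?thesis using big k\<Lambda> by (auto simp: s_def P0_def)
      next
        case 2
        then have "s p \<le> 3 * \<Lambda> + 1" using v_le[OF 2] xz_le[OF 2] T_prime[OF 2] by (simp add: s_def)
        then show ?thesis using big by linarith
      next
        case 3
        then show ?thesis using EE_le ixI[OF 3] P'_not[OF 3] by (auto simp: s_def split: prod.splits)
      qed
    qed
    have "card S \<le> card P0 + (card T + card P')"
      unfolding S_def by (meson add_left_mono card_Un_le order_trans)
    then show "card S \<le> C" using cardP0 cardT cardTk P'(2) by (simp add: C_def)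
  qed
  also have "\<dots> \<le> 2 ^ (\<Lambda> ^ 18)"
    using design_size_bound[of k \<Lambda>] k k\<Lambda> by (intro power_increasing) (auto simp: C_def)
  also have "\<dots> \<le> 2 ^ (2 ^ (t\<^sup>2))" using \<Lambda> by (intro power_increasing) auto
  finally have W_le: "W \<le> 2 ^ (2 ^ (t\<^sup>2))" .

  show ?thesis
  proof (rule consecutive_of_design[of t S N h e s])
    show "multiplicity p (N + h l) = e p l" if "p \<in> S" "l < 20 * t" for p l
      using r[OF that(1) N_cong[OF that(1)]] that by (simp add: k_def)
    show "e p l < s p" if "p \<in> S" "l < 20 * t" for p l using e_s that by (simp add: k_def)
    show "h i < h j" if "i < j" "j < 20 * t" for i j using h_less that by (simp add: k_def)
    show "p \<in> S" if "prime p" "i < j" "j < 20 * t" "p dvd h j - h i" for p i j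
      using that by (cases "p \<le> k") (auto simp: S_def P0_def T_def k_def[symmetric] not_le)
    show "multiplicity p (h j - h i) = min (e p i) (e p j)" if p: "p \<in> S" and ij': "i < j" "j < 20 * t" for p i j
    proof -
      have ij: "i < j" "j < k" using ij' by (auto simp: k_def)
      consider "p \<in> P0" | "p \<in> T" | "p \<in> P'" using p by (auto simp: S_def)
      then show ?thesis
      proof cases
        case 1
        then show ?thesis
          using multiplicity_diff_small_prime[of p "h i" i k "h j" j] h_small[of p] h_less ij
          by (auto simp: P0_def e_def)
      next
        case 2
        show ?thesis
        proof (cases "p dvd h j - h i")
          case True
          then have "i = \<alpha> p" "j = \<beta> p" using T_unique[OF 2 ij] by auto
          then show ?thesis using xz[OF 2] ij by (auto simp: e_T[OF 2] e0_def v_def)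
        next
          case False
          then have "\<not> (i = \<alpha> p \<and> j = \<beta> p)" using \<alpha>\<beta>(3)[OF 2] by auto
          then have "e0 p i = 0 \<or> e0 p j = 0" using \<alpha>\<beta>(1)[OF 2] ij by (auto simp: e0_def)
          then show ?thesis using False by (auto simp: e_T[OF 2] not_dvd_imp_multiplicity_0)
        qed
      next
        case 3
        have "\<not> p dvd h j - h i" using P'_not[OF 3] P'(3)[OF 3] ij by (auto simp: T_def)
        moreover have "e p i = 0 \<or> e p j = 0" using P'_not[OF 3] ij by (auto simp: e_def split: prod.splits)
        ultimately show ?thesis by (auto simp: not_dvd_imp_multiplicity_0)
      qed
    qed
    show "(\<Prod>p\<in>S. p ^ s p) \<le> 2 ^ (2 ^ (t\<^sup>2))" using W_le by (simp add: W_def)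
    show "N + h l \<le> (2 ^ (2 ^ (t\<^sup>2)))\<^sup>2" if "l < 20 * t" for l
    proof -
      define y :: nat where "y = 2 ^ (2 ^ (t\<^sup>2))"
      have "\<Lambda> \<le> \<Lambda> ^ 18" using k k\<Lambda> by (intro self_le_power) auto
      then have "(2::nat) ^ \<Lambda> \<le> y" unfolding y_def using \<Lambda> by (intro power_increasing) auto
      moreover have "h l \<le> 2 ^ \<Lambda>" using h_le that by (simp add: k_def)
      moreover have "W \<le> y" using W_le by (simp add: y_def)
      ultimately have "N + h l \<le> 3 * y" using N0(1) unfolding N_def by linarith
      also have "\<dots> \<le> y * y"
      proof (rule mult_right_mono)
        have "(2::nat) ^ 2 \<le> 2 ^ (2 ^ (t\<^sup>2))"
          using t by (intro power_increasing self_le_power) auto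
        then show "3 \<le> y" by (simp add: y_def)
      qed simp
      finally show ?thesis by (simp add: y_def power2_eq_square)
    qed
    show "(\<Prod>p\<in>S. e p j - e p i + 1) * b = a * (\<Prod>p\<in>S. e p i - e p j + 1)"
      if ij': "i < j" "j < 20 * t" for i j
    proof -
      have ij: "i < j" "j < k" "i < k" using ij' by (auto simp: k_def)
      have split: "(\<Prod>p\<in>S. f p) = (\<Prod>p\<in>P0. f p) * ((\<Prod>p\<in>T. f p) * (\<Prod>p\<in>P'. f p))" for f :: "nat \<Rightarrow> nat"
      proof -
        have "P0 \<inter> (T \<union> P') = {}" "T \<inter> P' = {}"
          using T_prime P'_not by (auto simp: P0_def not_le[symmetric])
        then show ?thesis
          unfolding S_def using finP0 finT P'(1) by (simp add: prod.union_disjoint)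
      qed
      \<comment> \<open>Among the compensating primes only those attached to \<open>j'\<close> leave
        a positive truncated difference, namely \<open>EE p j' - 1\<close>.\<close>
      have priv: "(\<Prod>p\<in>P'. e p j' - e p i' + 1) = (\<Prod>p\<in>T. EE p j')" if "i' < k" "j' < k" "i' \<noteq> j'" for i' j'
      proof -
        have "(\<Prod>p\<in>P'. e p j' - e p i' + 1) = (\<Prod>w\<in>T \<times> {..<k}. e (\<eta> w) j' - e (\<eta> w) i' + 1)"
          by (rule prod.reindex_bij_betw[OF \<eta>, of "\<lambda>p. e p j' - e p i' + 1", symmetric])
        also have "\<dots> = (\<Prod>p\<in>T. \<Prod>l<k. e (\<eta> (p, l)) j' - e (\<eta> (p, l)) i' + 1)"
          by (simp add: prod.cartesian_product case_prod_unfold)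
        also have "\<dots> = (\<Prod>p\<in>T. \<Prod>l<k. if l = j' then EE p j' else 1)"
        proof (intro prod.cong refl)
          fix p l assume "p \<in> T" "l \<in> {..<k}"
          then show "e (\<eta> (p, l)) j' - e (\<eta> (p, l)) i' + 1 = (if l = j' then EE p j' else 1)"
            using EE2[of p j'] that by (auto simp: e_\<eta>)
        qed
        also have "\<dots> = (\<Prod>p\<in>T. EE p j')" using that by (simp add: prod.delta)
        finally show ?thesis .
      qed
      have small: "(\<Prod>p\<in>P0. e p j - e p i + 1) = c i j" "(\<Prod>p\<in>P0. e p i - e p j + 1) = 1"
        using ij by (simp_all add: P0_def e_def c_def)
      \<comment> \<open>\<open>U p\<close> and \<open>V p\<close> combine the contribution of
        \<open>p\<close> with that of its compensating primes at \<open>j\<close> and at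
        \<open>i\<close>.\<close>
      define U where "U = (\<lambda>p. (e0 p j - e0 p i + 1) * EE p j)"
      define V where "V = (\<lambda>p. (e0 p i - e0 p j + 1) * EE p i)"
      have eT: "(\<Prod>p\<in>T. e p j' - e p i' + 1) = (\<Prod>p\<in>T. e0 p j' - e0 p i' + 1)" for i' j'
        by (intro prod.cong refl) (simp add: e_T)
      have LU: "(\<Prod>p\<in>S. e p j - e p i + 1) = c i j * (\<Prod>p\<in>T. U p)"
        unfolding split small priv[OF ij(3,2) less_imp_neq[OF ij(1)]]
        by (simp only: U_def prod.distrib eT)
      have LV: "(\<Prod>p\<in>S. e p i - e p j + 1) = (\<Prod>p\<in>T. V p)"
        unfolding split small priv[OF ij(2,3) less_imp_neq[OF ij(1), symmetric]]
        by (simp only: V_def prod.distrib eT mult_1)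
      define q1 q2 where "q1 = q i j True" and "q2 = q i j False"
      have qT: "q i j s \<in> T" for s
      proof -
        have "multiplicity (q i j s) (h j - h i) > 0" using q[OF ij(1,2), of s] M2[of i j s] by simp
        then have "q i j s dvd h j - h i" by (metis less_irrefl not_dvd_imp_multiplicity_0)
        then show ?thesis using q[OF ij(1,2)] ij by (auto simp: T_def)
      qed
      have q_ij: "\<alpha> (q i j s) = i \<and> \<beta> (q i j s) = j" for s
      proof -
        have "multiplicity (q i j s) (h j - h i) > 0" using q[OF ij(1,2), of s] M2[of i j s] by simp
        then have "q i j s dvd h j - h i" by (metis less_irrefl not_dvd_imp_multiplicity_0)
        then show ?thesis using T_unique[OF qT ij(1,2)] by simp
      qed
      have neq: "q1 \<noteq> q2" using q_neq[OF ij(1,2)] by (simp add: q1_def q2_def)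
      have rel: "EE p i * (1 + e0 p i) = EE p j * (1 + e0 p j)" for p by (simp only: EEK)
      have U1: "U q1 = a * V q1"
      proof -
        have e: "e0 q1 i = 2 * a - 1" "e0 q1 j = (2 * a - 1) + (2 * a - 2)"
          using q_ij[of True] q[OF ij(1,2), of True] neq ij
          by (auto simp: e0_def v_def x_def z_def M_def q1_def q2_def)
        have "((2 * a - 2) + 1) * EE q1 j = a * EE q1 i"
          by (rule compensated_factor_mult) (use rel[of q1, unfolded e] ab in simp_all)
        then show ?thesis unfolding U_def V_def e by simp
      qed
      have V2: "V q2 = (b * c i j) * U q2"
      proof -
        define d where "d = b * c i j"
        have e: "e0 q2 j = 2 * d - 1" "e0 q2 i = (2 * d - 1) + (2 * d - 2)"
          using q_ij[of False] q[OF ij(1,2), of False] neq ij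
          by (auto simp: e0_def v_def x_def z_def M_def q1_def q2_def d_def)
        have "((2 * d - 2) + 1) * EE q2 i = d * EE q2 j"
          by (rule compensated_factor_mult) (use rel[of q2, unfolded e] ab c_pos[of i j] in \<open>simp_all add: d_def\<close>)
        then show ?thesis unfolding U_def V_def e d_def[symmetric] by simp
      qed
      have UV: "U p = V p" if "p \<in> T - {q1, q2}" for p
      proof -
        have pT: "p \<in> T" using that by simp
        have "e0 p i = 0 \<or> e0 p j = 0 \<or> e0 p i = e0 p j"
        proof (cases "i = \<alpha> p \<and> j = \<beta> p")
          case True
          then have "x p = 0" "z p = 0" using that by (auto simp: x_def z_def q1_def q2_def)
          then show ?thesis using True ij by (auto simp: e0_def)
        next
          case False
          then show ?thesis using \<alpha>\<beta>(1)[OF pT] ij by (auto simp: e0_def)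
        qed
        then show ?thesis unfolding U_def V_def by (rule compensated_factor_eq[OF rel])
      qed
      have T_split: "(\<Prod>p\<in>T. f p) = f q1 * (f q2 * (\<Prod>p\<in>T - {q1, q2}. f p))" for f :: "nat \<Rightarrow> nat"
      proof -
        have "(\<Prod>p\<in>T. f p) = f q1 * (\<Prod>p\<in>T - {q1}. f p)"
          using finT qT by (intro prod.remove) (auto simp: q1_def)
        also have "(\<Prod>p\<in>T - {q1}. f p) = f q2 * (\<Prod>p\<in>T - {q1} - {q2}. f p)"
          using finT qT neq by (intro prod.remove) (auto simp: q2_def)
        also have "T - {q1} - {q2} = T - {q1, q2}" by auto
        finally show ?thesis .
      qed
      \<comment> \<open>Only \<open>q1\<close> and \<open>q2\<close> have a net effect:
        \<open>q1\<close> gives the factor \<open>a\<close>, and \<open>q2\<close> gives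
        \<open>b * c i j\<close> on the other side, where \<open>c i j\<close> cancels against the
        small primes.\<close>
      have "(\<Prod>p\<in>T - {q1, q2}. U p) = (\<Prod>p\<in>T - {q1, q2}. V p)" using UV by (intro prod.cong refl)
      then show ?thesis
        unfolding LU LV T_split U1 V2 by (simp add: mult_ac)
    qed
  qed (use S t N_pos in \<open>auto simp: k_def\<close>)
qed

section \<open>Growth of the parameters and density of the logarithms\<close>

text \<open>For large \<open>k\<close> the size is at most \<open>k ^ (5 * k)\<close>. With
  \<open>k = 20 * t\<close> its 18th power is at most \<open>(20 * t) ^ (1800 * t)\<close>, whose
  logarithm is of order \<open>t log t\<close> and loses against \<open>t^2\<close>.\<close>

lemma eventually_design_size_le:
  fixes a b :: nat
  defines "\<Lambda> \<equiv> \<lambda>k::nat. (2 + (k + 1 + 2 * k\<^sup>2) * (2 * k\<^sup>2 + k + 6)\<^sup>2 * (k + (2 * a + 2 * b * k ^ k))) * (k\<^sup>2 + 1) ^ k"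
  shows "\<forall>\<^sub>F t in sequentially. \<Lambda> (20 * t) ^ 18 \<le> 2 ^ (t\<^sup>2)"
proof -
  have \<Lambda>_le: "\<Lambda> k \<le> k ^ (5 * k)" if k: "k \<ge> 60" "k \<ge> a" "k \<ge> b" for k
  proof -
    have k2: "k\<^sup>2 = k * k" and k3: "k ^ 3 = k * k * k" by (simp_all add: power2_eq_square power3_eq_cube)
    have "60 * k \<le> k\<^sup>2" unfolding k2 using k by (intro mult_right_mono) auto
    moreover have "60 * k\<^sup>2 \<le> k ^ 3" unfolding k2 k3 using mult_right_mono[OF k(1), of "k * k"] by (simp add: mult.assoc)
    ultimately have b1: "k + 1 + 2 * k\<^sup>2 \<le> k ^ 3" and b2: "2 * k\<^sup>2 + k + 6 \<le> k ^ 3" and b3: "k\<^sup>2 + 1 \<le> k ^ 3"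
      using k by linarith+
    have "k + (2 * a + 2 * b * k ^ k) \<le> k * k ^ k + (2 * (k * k ^ k) + 2 * (k * k ^ k))"
      using k by (intro add_mono) (auto simp: mult.assoc intro!: mult_le_mono order_trans[of a k "k * k ^ k"])
    also have "\<dots> = 5 * (k * k ^ k)" by simp
    also have "\<dots> \<le> k * (k * k ^ k)" using k by (intro mult_right_mono) auto
    also have "\<dots> = k ^ (k + 2)" by (simp add: eval_nat_numeral)
    finally have b4: "k + (2 * a + 2 * b * k ^ k) \<le> k ^ (k + 2)" .
    have "(k + 1 + 2 * k\<^sup>2) * (2 * k\<^sup>2 + k + 6)\<^sup>2 * (k + (2 * a + 2 * b * k ^ k)) \<le> k ^ 3 * (k ^ 3)\<^sup>2 * k ^ (k + 2)"
      using b1 b2 b4 by (intro mult_le_mono power_mono) auto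
    also have "\<dots> = k ^ (k + 11)" by (simp add: eval_nat_numeral power_add mult_ac)
    finally have "2 + (k + 1 + 2 * k\<^sup>2) * (2 * k\<^sup>2 + k + 6)\<^sup>2 * (k + (2 * a + 2 * b * k ^ k)) \<le> 2 + k ^ (k + 11)"
      by (rule add_left_mono)
    also have "\<dots> \<le> 2 * k ^ (k + 11) + k ^ (k + 11)"
      using k by (intro add_right_mono) simp
    also have "\<dots> = 3 * k ^ (k + 11)" by simp
    also have "\<dots> \<le> k * k ^ (k + 11)" using k by (intro mult_right_mono) auto
    also have "\<dots> = k ^ (k + 12)" by (simp add: eval_nat_numeral)
    finally have "\<Lambda> k \<le> k ^ (k + 12) * (k ^ 3) ^ k"
      unfolding \<Lambda>_def using b3 by (intro mult_le_mono power_mono) auto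
    also have "\<dots> = k ^ (k + 12 + 3 * k)" by (simp only: power_add power_mult)
    also have "\<dots> \<le> k ^ (5 * k)" using k by (intro power_increasing) auto
    finally show ?thesis .
  qed
  \<comment> \<open>The constant is \<open>5 * 20 * 18 = 1800\<close>: raising to the power
    \<open>1800 * t\<close> turns the right-hand side into 2 to the power
    \<open>t^2\<close>.\<close>
  have "\<forall>\<^sub>F t in sequentially. 20 * real t \<le> 2 powr (real t / 1800)" by real_asymp
  then show ?thesis
    using eventually_ge_at_top[of "3 + a + b"]
  proof eventually_elim
    case (elim t)
    have "real (\<Lambda> (20 * t) ^ 18) \<le> real (((20 * t) ^ (5 * (20 * t))) ^ 18)"
      using elim by (intro of_nat_mono power_mono \<Lambda>_le) auto
    also have "((20 * t) ^ (5 * (20 * t))) ^ 18 = (20 * t) ^ (5 * (20 * t) * 18)"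
      by (simp only: power_mult)
    also have "real \<dots> = (20 * real t) ^ (1800 * t)" by simp
    also have "\<dots> \<le> (2 powr (real t / 1800)) ^ (1800 * t)"
      using elim by (intro power_mono) auto
    also have "\<dots> = 2 powr (real (t\<^sup>2))"
      by (subst powr_realpow[symmetric]) (simp_all add: powr_powr power2_eq_square)
    also have "\<dots> = real (2 ^ (t\<^sup>2))" by (subst powr_realpow) simp_all
    finally show ?case by (simp only: of_nat_le_iff)
  qed
qed

text \<open>\<open>ratio_attained\<close> works for all large \<open>t\<close> and returns an
  \<open>n\<close> that grows with \<open>t\<close>.\<close>

lemma infinite_ratio:
  assumes "a > 0" "b > 0"
  shows "infinite {n. n > 0 \<and> divisor_count (n + 1) * b = a * divisor_count n}"
  unfolding infinite_nat_iff_unbounded_le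
proof
  fix m :: nat
  obtain t0 where t0: "\<And>t. t \<ge> t0 \<Longrightarrow>
      ((2 + (20 * t + 1 + 2 * (20 * t)\<^sup>2) * (2 * (20 * t)\<^sup>2 + 20 * t + 6)\<^sup>2 *
        (20 * t + (2 * a + 2 * b * (20 * t) ^ (20 * t)))) * ((20 * t)\<^sup>2 + 1) ^ (20 * t)) ^ 18 \<le> 2 ^ (t\<^sup>2)"
    using eventually_design_size_le[of a b] unfolding eventually_sequentially by blast
  define t where "t = max (max t0 3) m"
  have t: "t \<ge> t0" "t \<ge> 3" "t \<ge> m" by (auto simp: t_def)
  obtain n where n: "n \<ge> 2 ^ (2 ^ (t\<^sup>2))" "divisor_count (n + 1) * b = a * divisor_count n"
    using ratio_attained[OF assms t(2) t0[OF t(1)]] by blast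
  have "m \<le> t" by (rule t)
  also have "t \<le> t\<^sup>2" by (rule self_le_power) (use t in auto)
  also have "\<dots> \<le> 2 ^ (t\<^sup>2)" by (simp add: less_imp_le)
  also have "\<dots> \<le> 2 ^ (2 ^ (t\<^sup>2))" by (simp add: less_imp_le)
  also note n(1)
  finally have "m \<le> n" .
  moreover have "n > 0" using n(1) by (rule less_le_trans[rotated]) simp
  ultimately show "\<exists>n\<ge>m. n \<in> {n. n > 0 \<and> divisor_count (n + 1) * b = a * divisor_count n}"
    using n(2) by blast
qed

text \<open>Positive rationals are dense in the positive reals, and \<open>ln\<close> carries this
  to the whole line.\<close>

lemma limit_set_eq_UNIV:
  assumes ratios: "\<And>a b. a > 0 \<Longrightarrow> b > 0 \<Longrightarrow>
    infinite {n. n > 0 \<and> divisor_count (n + 1) * b = a * divisor_count n}"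
  shows "limit_set = UNIV"
proof -
  have "\<exists>y. y \<in> {\<alpha>. infinite {n::nat. n > 0 \<and>
     \<alpha> = ln (real (divisor_count (n + 1)) / real (divisor_count n))}} \<and> dist y x < e"
    if "e > 0" for x e :: real
  proof -
    have "exp x < exp (x + e)" using that by simp
    then obtain q where q: "exp x < of_rat q" "of_rat q < exp (x + e)"
      using of_rat_dense by blast
    then have q0: "of_rat q > (0::real)" using exp_gt_zero[of x] by linarith
    then have "q > 0" by simp
    obtain c d where cd: "quotient_of q = (c, d)" by fastforce
    have d: "d > 0" and qcd: "q = of_int c / of_int d"
      using quotient_of_denom_pos[OF cd] quotient_of_div[OF cd] by auto
    have c: "c > 0" using \<open>q > 0\<close> d qcd by (simp add: zero_less_divide_iff)
    define a b where "a = nat c" and "b = nat d"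
    have ab: "a > 0" "b > 0" and qab: "of_rat q = real a / real b"
      using c d by (auto simp: a_def b_def qcd of_rat_divide)
    have "infinite {n. n > 0 \<and> ln (real a / real b) =
        ln (real (divisor_count (n + 1)) / real (divisor_count n))}"
    proof (rule infinite_super[OF _ ratios[OF ab]], clarify)
      fix n :: nat assume n: "n > 0" "divisor_count (n + 1) * b = a * divisor_count n"
      from n(2) have "real (divisor_count (n + 1)) * real b = real a * real (divisor_count n)"
        by (metis of_nat_mult)
      then have "real (divisor_count (n + 1)) / real (divisor_count n) = real a / real b"
        using ab divisor_count_pos[OF n(1)] by (simp add: field_simps)
      then show "ln (real a / real b) = ln (real (divisor_count (n + 1)) / real (divisor_count n))"
        by simp
    qed
    moreover have "x < ln (of_rat q)" "ln (of_rat q) < x + e"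
      using q ln_less_cancel_iff[of "exp x" "of_rat q"] ln_less_cancel_iff[of "of_rat q" "exp (x + e)"] q0
      by (simp_all del: ln_less_cancel_iff)
    ultimately show ?thesis
      by (intro exI[of _ "ln (real a / real b)"]) (simp add: qab dist_real_def)
  qed
  then show ?thesis
    unfolding limit_set_def by (auto simp: closure_approachable)
qed

theorem theorem1p2:
  shows "(\<forall>x::real. x > 0 \<longrightarrow> min (L_plus x) (L_minus x) \<ge> x / 2) \<and>
    Limsup at_top (\<lambda>x::real. ereal (1 / x * min (L_plus x) (L_minus x))) \<ge> ereal (2 / 3)"
proof -
  have L: "limit_set = UNIV" by (rule limit_set_eq_UNIV[OF infinite_ratio])
  \<comment> \<open>Both intersections are now full intervals of length \<open>x\<close>, so both
    claims hold with the constant 1.\<close>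
  have eq: "min (L_plus x) (L_minus x) = x" if "x > 0" for x
    using that L by (simp add: L_plus_def L_minus_def)
  have "eventually (\<lambda>x::real. ereal (1 / x * min (L_plus x) (L_minus x)) = 1) at_top"
    using eventually_gt_at_top[of 0] by eventually_elim (simp add: eq one_ereal_def)
  then have "Limsup at_top (\<lambda>x::real. ereal (1 / x * min (L_plus x) (L_minus x))) =
      Limsup at_top (\<lambda>x::real. (1::ereal))"
    by (rule Limsup_eq)
  then show ?thesis
    using eq by (simp add: Limsup_const)
qed

end
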